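(* For every $d\ge0$, the inductive dimension of $\mathcal{S}(\mathbf{R}^d)$ equals $d^2$.
   Context: $\mathcal{S}(\mathbf{R}^d)$ is the space of closed subgroups of $\mathbf{R}^d$ with the Chabauty topology. The (small) inductive dimension is defined by $\mathrm{indim}(\emptyset)=-1$ and $\mathrm{indim}(X)\le n$ iff every point has a basis of closed neighbourhoods whose boundaries have inductive dimension $\le n-1$. *)

theory Defs
  imports "HOL-Analysis.Analysis"
begin

text \<open>Chabauty (Fell) topology on the closed subsets of a topological space X:
  generated by the sets {F closed. F \<inter> K = {}} (K compact) and
  {F closed. F \<inter> U \<noteq> {}} (U open). Its topspace is the set of closed subsets.\<close>
definition chabauty_topology :: "'a topology \<Rightarrow> 'a set topology" where
  "chabauty_topology X = topology_generated_by
     ({{F. closedin X F \<and> F \<inter> K = {}} | K. compactin X K} \<union>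
      {{F. closedin X F \<and> F \<inter> U \<noteq> {}} | U. openin X U})"

text \<open>Closed subgroups of R^d, where R^d is the library's Euclidean_space d
  (functions nat \<Rightarrow> real vanishing from index d on).\<close>
definition closed_subgroups :: "nat \<Rightarrow> (nat \<Rightarrow> real) set set" where
  "closed_subgroups d = {H. closedin (Euclidean_space d) H \<and> (\<lambda>i. 0) \<in> H \<and>
      (\<forall>x\<in>H. \<forall>y\<in>H. (\<lambda>i. x i + y i) \<in> H) \<and> (\<forall>x\<in>H. (\<lambda>i. - x i) \<in> H)}"

definition Sub_space :: "nat \<Rightarrow> (nat \<Rightarrow> real) set topology" where
  "Sub_space d = subtopology (chabauty_topology (Euclidean_space d)) (closed_subgroups d)"

text \<open>Small inductive dimension. ind_le n X means indim X \<le> int n - 1.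
  indim \<le> -1 iff the space is empty; indim \<le> m iff every point has a basis of
  closed neighbourhoods whose boundaries have indim \<le> m - 1.\<close>
primrec ind_le :: "nat \<Rightarrow> 'a topology \<Rightarrow> bool" where
  "ind_le 0 X = (topspace X = {})"
| "ind_le (Suc n) X = (\<forall>x\<in>topspace X. \<forall>U. openin X U \<and> x \<in> U \<longrightarrow>
      (\<exists>V. closedin X V \<and> x \<in> X interior_of V \<and> V \<subseteq> U \<and>
           ind_le n (subtopology X (X frontier_of V))))"

definition indim_eq :: "'a topology \<Rightarrow> nat \<Rightarrow> bool" where
  "indim_eq X m = (ind_le (Suc m) X \<and> \<not> ind_le m X)"

end

theory Submission
  imports Defs "HOL-Homology.Brouwer_Degree"
begin

text \<open>Upper bound: a space whose topology is generated by a family of real functions, and which is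
  null for the \<open>(n+1)\<close>-dimensional Hausdorff measure built from their oscillations, has dimension
  at most \<open>n\<close>, since almost every level set of a finite sum \<open>\<Sum>\<bar>\<phi> - \<phi> x\<bar>\<close> is null in one dimension less.
  The Chabauty topology is generated by the distances to the points of \<open>R^d\<close>. Every closed subgroup
  consists of the combinations of some \<open>d\<close> vectors with coefficients in \<open>R\<close>, \<open>Z\<close> or \<open>0\<close>, and these
  distances depend on the vectors in a locally Lipschitz way, so \<open>S(R^d)\<close> is a countable union of
  Lipschitz images of subsets of \<open>R^(d^2)\<close>.

  Lower bound: if a compact Hausdorff space has dimension less than \<open>n\<close>, then maps from closed subsets
  to \<open>R^n - 0\<close> extend to the space. By Brouwer this fails for the \<open>d^2\<close>-dimensional cube, which embeds
  into \<open>S(R^d)\<close> by sending a matrix \<open>T\<close> close to the identity to the lattice \<open>T Z^d\<close>.\<close>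

text \<open>Dimension is not controlled under countable unions of arbitrary pieces, whereas null
  sets are. So the parameter count is carried out on null sets, and the dimension is read off once,
  for the whole space: a box in \<open>R^N\<close> has about \<open>K^N\<close> cells of size
  \<open>1 / K\<close>, so its Lipschitz images are null in dimension \<open>N + 1\<close>.
  Oscillations of a family of functions serve as sizes and stand in for a metric on the Chabauty
  space. A degenerating matrix lets large coefficients produce short vectors, and then the distance
  from a point to the generated group is out of control. Hence the generators come with a bound of
  the coefficients by the norm of the combination; the matrices obeying it with one constant form
  one piece, and integer constants exhaust all closed subgroups. Finding such generators is the
  content of the structure theorem. In the lower bound all functions live on one compact space and
  only the set where zeros are forbidden varies, so that Tietze applies in the same space throughout
  the induction on dimension.\<close>

section \<open>Dimension and extension of nowhere vanishing maps\<close>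

text \<open>The family \<open>f 0, ..., f (n - 1)\<close> is a map to \<open>R^n\<close>.\<close>
definition rel_ext :: "'a topology \<Rightarrow> nat \<Rightarrow> 'a set \<Rightarrow> bool" where
  "rel_ext X n A \<longleftrightarrow> (\<forall>E f. closedin X E \<and> (\<forall>i<n. continuous_map X euclideanreal (f i)) \<and>
      (\<forall>x\<in>E \<inter> A. \<exists>i<n. f i x \<noteq> 0) \<longrightarrow>
      (\<exists>g. (\<forall>i<n. continuous_map X euclideanreal (g i)) \<and> (\<forall>x\<in>E. \<forall>i<n. g i x = f i x) \<and>
           (\<forall>x\<in>A. \<exists>i<n. g i x \<noteq> 0)))"

lemma rel_extD:
  assumes "rel_ext X n A" "closedin X E" "\<And>i. i < n \<Longrightarrow> continuous_map X euclideanreal (f i)"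
    "\<And>x. x \<in> E \<Longrightarrow> x \<in> A \<Longrightarrow> \<exists>i<n. f i x \<noteq> 0"
  obtains g where "\<And>i. i < n \<Longrightarrow> continuous_map X euclideanreal (g i)"
    "\<And>x i. x \<in> E \<Longrightarrow> i < n \<Longrightarrow> g i x = f i x" "\<And>x. x \<in> A \<Longrightarrow> \<exists>i<n. g i x \<noteq> 0"
  using assms unfolding rel_ext_def by (smt (verit, best) IntE)

text \<open>The two functions paste to a continuous one on the closed union, and Tietze extends it.
  This allows changing a function on one closed set while keeping its values on another.\<close>

lemma continuous_map_glue:
  fixes f k :: "'a \<Rightarrow> real"
  assumes X: "normal_space X" and A: "closedin X A" and B: "closedin X B"
    and f: "continuous_map X euclideanreal f" and k: "continuous_map X euclideanreal k"
    and eq: "\<And>x. x \<in> A \<Longrightarrow> x \<in> B \<Longrightarrow> f x = k x"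
  obtains h where "continuous_map X euclideanreal h" "\<And>x. x \<in> A \<Longrightarrow> h x = f x" "\<And>x. x \<in> B \<Longrightarrow> h x = k x"
proof -
  define u where "u = (\<lambda>x. if x \<in> A then f x else k x)"
  have uA: "u x = f x" if "x \<in> A" for x using that by (simp add: u_def)
  have uB: "u x = k x" if "x \<in> B" for x using that eq by (simp add: u_def)
  have AX: "A \<subseteq> topspace X" "B \<subseteq> topspace X" using A B closedin_subset by auto
  have "continuous_map (subtopology X (A \<union> B)) euclideanreal u"
    unfolding continuous_map_closedin
  proof (intro conjI allI impI)
    fix C :: "real set" assume C: "closedin euclidean C"
    have "closedin X (A \<inter> {x \<in> topspace X. f x \<in> C} \<union> B \<inter> {x \<in> topspace X. k x \<in> C})"
      using A B f k C by (intro closedin_Un closedin_Int) (auto simp: continuous_map_closedin)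
    moreover have "{x \<in> topspace (subtopology X (A \<union> B)). u x \<in> C} =
        (A \<union> B) \<inter> (A \<inter> {x \<in> topspace X. f x \<in> C} \<union> B \<inter> {x \<in> topspace X. k x \<in> C})"
      (is "?l = ?r")
    proof (rule Set.set_eqI)
      fix x show "x \<in> ?l \<longleftrightarrow> x \<in> ?r"
        using AX uA[of x] uB[of x] by (cases "x \<in> A"; cases "x \<in> B") auto
    qed
    ultimately show "closedin (subtopology X (A \<union> B)) {x \<in> topspace (subtopology X (A \<union> B)). u x \<in> C}"
      by (simp only: closedin_subtopology_Int_closed)
  qed auto
  then obtain h where "continuous_map X euclideanreal h" "\<And>x. x \<in> A \<union> B \<Longrightarrow> h x = u x"
    using Tietze_extension_realinterval[OF X closedin_Un[OF A B], of UNIV u] by auto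
  then show thesis using that uA uB by auto
qed

text \<open>The family may have zeros on \<open>E \<inter> A\<close> outside \<open>B\<close>, so
  the extension over \<open>A\<close> starts from \<open>E \<inter> B\<close> only. Its values on
  \<open>B\<close> are then glued to the original values on \<open>E\<close>.\<close>

lemma rel_ext_subset:
  assumes X: "normal_space X" and A: "closedin X A" and "closedin X B" "B \<subseteq> A" and ext: "rel_ext X n A"
  shows "rel_ext X n B"
  unfolding rel_ext_def
proof (intro allI impI, elim conjE)
  fix E and f :: "nat \<Rightarrow> 'a \<Rightarrow> real"
  assume E: "closedin X E" and f: "\<forall>i<n. continuous_map X euclideanreal (f i)"
    and nz: "\<forall>x\<in>E \<inter> B. \<exists>i<n. f i x \<noteq> 0"
  have "closedin X (E \<inter> B)" using E assms by auto
  from rel_extD[OF ext this, of f] f nz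
  obtain g where g: "\<And>i. i < n \<Longrightarrow> continuous_map X euclideanreal (g i)"
    "\<And>x i. x \<in> E \<inter> B \<Longrightarrow> i < n \<Longrightarrow> g i x = f i x" "\<And>x. x \<in> A \<Longrightarrow> \<exists>i<n. g i x \<noteq> 0"
    by blast
  have "\<exists>h. continuous_map X euclideanreal h \<and> (\<forall>x\<in>E. h x = f i x) \<and> (\<forall>x\<in>B. h x = g i x)" if "i < n" for i
    using continuous_map_glue[OF X E \<open>closedin X B\<close>, of "f i" "g i"] f g that by (metis Int_iff)
  then obtain h where "\<And>i. i < n \<Longrightarrow> continuous_map X euclideanreal (h i) \<and> (\<forall>x\<in>E. h i x = f i x) \<and> (\<forall>x\<in>B. h i x = g i x)"
    by metis
  with g(3) \<open>B \<subseteq> A\<close> show "\<exists>g. (\<forall>i<n. continuous_map X euclideanreal (g i)) \<and> (\<forall>x\<in>E. \<forall>i<n. g i x = f i x) \<and>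
           (\<forall>x\<in>B. \<exists>i<n. g i x \<noteq> 0)"
    by (intro exI[of _ h]) (metis subset_iff)
qed

text \<open>After the extension over \<open>A\<close>, the whole of \<open>E \<union> A\<close> is
  prescribed for the extension over \<open>B\<close>, so the absence of common zeros on
  \<open>A\<close> survives.\<close>

lemma rel_ext_Un:
  assumes A: "closedin X A" "rel_ext X n A" and B: "rel_ext X n B"
  shows "rel_ext X n (A \<union> B)"
  unfolding rel_ext_def
proof (intro allI impI, elim conjE)
  fix E and f :: "nat \<Rightarrow> 'a \<Rightarrow> real"
  assume E: "closedin X E" and f: "\<forall>i<n. continuous_map X euclideanreal (f i)"
    and nz: "\<forall>x\<in>E \<inter> (A \<union> B). \<exists>i<n. f i x \<noteq> 0"
  from rel_extD[OF A(2) E, of f] f nz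
  obtain g where g: "\<And>i. i < n \<Longrightarrow> continuous_map X euclideanreal (g i)"
    "\<And>x i. x \<in> E \<Longrightarrow> i < n \<Longrightarrow> g i x = f i x" "\<And>x. x \<in> A \<Longrightarrow> \<exists>i<n. g i x \<noteq> 0"
    by blast
  have "\<exists>i<n. g i x \<noteq> 0" if "x \<in> E \<union> A" "x \<in> B" for x
    using that g nz by (metis Int_iff Un_iff)
  with rel_extD[OF B closedin_Un[OF E A(1)], of g] g
  obtain h where h: "\<And>i. i < n \<Longrightarrow> continuous_map X euclideanreal (h i)"
    "\<And>x i. x \<in> E \<union> A \<Longrightarrow> i < n \<Longrightarrow> h i x = g i x" "\<And>x. x \<in> B \<Longrightarrow> \<exists>i<n. h i x \<noteq> 0"
    by blast
  show "\<exists>g. (\<forall>i<n. continuous_map X euclideanreal (g i)) \<and> (\<forall>x\<in>E. \<forall>i<n. g i x = f i x) \<and>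
           (\<forall>x\<in>A \<union> B. \<exists>i<n. g i x \<noteq> 0)"
    using g h by (intro exI[of _ h]) (metis Un_iff)
qed

lemma rel_ext_empty: "rel_ext X n {}"
  unfolding rel_ext_def by blast

lemma rel_ext_Union:
  assumes "finite \<F>" "\<And>A. A \<in> \<F> \<Longrightarrow> closedin X A \<and> rel_ext X n A"
  shows "rel_ext X n (\<Union>\<F>)"
  using assms by (induction) (auto simp: rel_ext_empty rel_ext_Un)

lemma closedin_zeros:
  assumes "closedin X A" "\<And>i. i < (n::nat) \<Longrightarrow> continuous_map X euclideanreal (f i)"
  shows "closedin X {x \<in> A. \<forall>i<n. f i x = 0}"
proof -
  have "{x \<in> A. \<forall>i<n. f i x = 0} = A \<inter> (\<Inter>i\<in>{..<n}. {x \<in> topspace X. f i x \<in> {0}}) " 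
    using closedin_subset[OF assms(1)] by auto
  also have "closedin X \<dots>"
  proof (cases "n = 0")
    case False
    then show ?thesis using assms
      by (intro closedin_Int closedin_INT closedin_continuous_map_preimage) auto
  qed (use assms in auto)
  finally show ?thesis .
qed

text \<open>Induction on dimension, with the last function treated apart. At the common zeros of the
  other \<open>n\<close> functions on \<open>E \<inter> A\<close> the last one has a sign. A
  separator of the positive from the negative points has one dimension less, so the \<open>n\<close>
  functions extend without common zeros on it. Their remaining common zeros in \<open>A\<close> fall
  into two disjoint closed parts, and the last function is made positive on one and negative on the
  other.\<close>

lemma ind_le_imp_rel_ext:
  assumes X: "compact_space X" "Hausdorff_space X"
  shows "closedin X A \<Longrightarrow> ind_le n (subtopology X A) \<Longrightarrow> rel_ext X n A"
proof (induction n arbitrary: A)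
  case 0
  then have "A = {}" using closedin_subset by fastforce
  then show ?case by (simp add: rel_ext_empty)
next
  case (Suc n)
  have norm: "normal_space X" using X by (simp add: compact_Hausdorff_or_regular_imp_normal_space)
  have AX: "A \<subseteq> topspace X" using Suc.prems closedin_subset by blast
  let ?S = "subtopology X A"
  show ?case
    unfolding rel_ext_def
  proof (intro allI impI, elim conjE)
    fix E and f :: "nat \<Rightarrow> 'a \<Rightarrow> real"
    assume E: "closedin X E" and f: "\<forall>i<Suc n. continuous_map X euclideanreal (f i)"
      and nz: "\<forall>x\<in>E \<inter> A. \<exists>i<Suc n. f i x \<noteq> 0"
    define Z0 where "Z0 = {x \<in> E \<inter> A. \<forall>i<n. f i x = 0}"
    have Z0: "closedin X Z0"
      unfolding Z0_def using E Suc.prems f by (intro closedin_zeros) auto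
    define C where "C = Z0 \<inter> {x \<in> topspace X. f n x \<in> {0..}}"
    define D where "D = Z0 \<inter> {x \<in> topspace X. f n x \<in> {..0}}"
    have fn: "continuous_map X euclideanreal (f n)" using f by auto
    have C: "closedin X C"
      unfolding C_def by (intro closedin_Int Z0 closedin_continuous_map_preimage[OF fn]) simp
    have D: "closedin X D"
      unfolding D_def by (intro closedin_Int Z0 closedin_continuous_map_preimage[OF fn]) simp
    have nzn: "f n x \<noteq> 0" if "x \<in> Z0" for x
      using nz that less_Suc_eq by (auto simp: Z0_def)
    have Cpos: "f n x > 0" if "x \<in> C" for x using nzn[of x] that by (auto simp: C_def)
    have Dneg: "f n x < 0" if "x \<in> D" for x using nzn[of x] that by (auto simp: D_def)
    have Z0CD: "Z0 \<subseteq> C \<union> D" using closedin_subset[OF Z0] by (auto simp: C_def D_def)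
    have CA: "C \<subseteq> A" and CE: "C \<subseteq> E" and DA: "D \<subseteq> A" and DE: "D \<subseteq> E" by (auto simp: C_def D_def Z0_def)
    have opD: "openin ?S (A - D)"
      using openin_diff[OF openin_topspace[of ?S] closedin_subset_topspace[OF D DA]] AX
      by (simp add: inf.absorb2)
    \<comment> \<open>Every point of \<open>C\<close> has a neighbourhood in \<open>A\<close> that
      avoids \<open>D\<close> and has a frontier of smaller dimension; compactness of
      \<open>C\<close> leaves finitely many.\<close>
    have "\<exists>V. closedin ?S V \<and> x \<in> ?S interior_of V \<and> V \<subseteq> A - D \<and> ind_le n (subtopology ?S (?S frontier_of V))"
      if "x \<in> C" for x
    proof -
      have "x \<in> A - D" using that CA Cpos Dneg by force
      then have "x \<in> topspace ?S" using AX by auto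
      with \<open>x \<in> A - D\<close> opD Suc.prems(2) show ?thesis by auto
    qed
    then obtain V where V: "\<And>x. x \<in> C \<Longrightarrow> closedin ?S (V x)" "\<And>x. x \<in> C \<Longrightarrow> x \<in> ?S interior_of (V x)"
      "\<And>x. x \<in> C \<Longrightarrow> V x \<subseteq> A - D" "\<And>x. x \<in> C \<Longrightarrow> ind_le n (subtopology ?S (?S frontier_of (V x)))"
      by metis
    have "compactin ?S C"
      using C X CA by (simp add: closedin_compact_space compactin_subtopology)
    moreover have "\<And>U. U \<in> (\<lambda>x. ?S interior_of (V x)) ` C \<Longrightarrow> openin ?S U" by auto
    moreover have "C \<subseteq> \<Union>((\<lambda>x. ?S interior_of (V x)) ` C)" using V(2) by auto
    ultimately obtain \<F> where \<F>: "finite \<F>" "\<F> \<subseteq> (\<lambda>x. ?S interior_of (V x)) ` C" "C \<subseteq> \<Union>\<F>"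
      by (metis compactinD)
    then obtain T where T: "finite T" "T \<subseteq> C" "\<F> = (\<lambda>x. ?S interior_of (V x)) ` T"
      by (meson finite_subset_image)
    define W where "W = (\<Union>x\<in>T. V x)"
    define U where "U = (\<Union>x\<in>T. ?S interior_of (V x))"
    have closA: "closedin X F" if "closedin ?S F" for F
      using that Suc.prems(1) closedin_trans_full by blast
    have UW: "U \<subseteq> W" unfolding U_def W_def using interior_of_subset by fastforce
    have CU: "C \<subseteq> U" using \<F> T by (auto simp: U_def)
    have W: "closedin ?S W" unfolding W_def using T V(1) by (intro closedin_Union) auto
    have U: "openin ?S U" unfolding U_def by (intro openin_Union) auto
    have WD: "W \<inter> D = {}" and WA: "W \<subseteq> A" using V(3) T by (fastforce simp: W_def)+
    \<comment> \<open>\<open>C \<subseteq> U \<subseteq> W\<close> with \<open>U\<close> open and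
      \<open>W\<close> closed in \<open>A\<close>, and \<open>W\<close> misses \<open>D\<close>. So
      \<open>L\<close> separates \<open>C\<close> from \<open>D\<close>, and it lies in the union of
      the finitely many frontiers.\<close>
    define L where "L = W - U"
    have L: "closedin X L" unfolding L_def using W U by (intro closA closedin_diff)
    have LA: "L \<subseteq> A" using WA L_def by auto
    have fr: "closedin X (?S frontier_of V x) \<and> rel_ext X n (?S frontier_of V x)" if "x \<in> C" for x
    proof -
      have c: "closedin X (?S frontier_of V x)" by (simp add: closA closedin_frontier_of)
      have "?S frontier_of V x \<subseteq> A" by (simp add: frontier_of_subset_subtopology)
      then have "subtopology ?S (?S frontier_of V x) = subtopology X (?S frontier_of V x)"
        by (metis inf.absorb_iff2 subtopology_subtopology)
      with Suc.IH c V(4)[OF that] show ?thesis by auto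
    qed
    have "L \<subseteq> (\<Union>x\<in>T. ?S frontier_of V x)"
    proof
      fix y assume "y \<in> L"
      then obtain x where x: "x \<in> T" "y \<in> V x" "y \<notin> ?S interior_of V x" by (auto simp: L_def W_def U_def)
      then have "y \<in> ?S frontier_of V x"
        using V(1) T(2) by (auto simp: frontier_of_def closure_of_closedin)
      with x show "y \<in> (\<Union>x\<in>T. ?S frontier_of V x)" by auto
    qed
    moreover have "rel_ext X n (\<Union>((\<lambda>x. ?S frontier_of V x) ` T))"
      using T fr by (intro rel_ext_Union) auto
    moreover have "closedin X (\<Union>((\<lambda>x. ?S frontier_of V x) ` T))"
      using T fr by (intro closedin_Union) auto
    ultimately have Lext: "rel_ext X n L"
      using rel_ext_subset norm L by metis
    have "\<exists>i<n. f i x \<noteq> 0" if "x \<in> E" "x \<in> L" for x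
    proof (rule ccontr)
      assume "\<not> ?thesis"
      then have "x \<in> Z0" using that LA by (auto simp: Z0_def)
      then show False using Z0CD that CU WD by (auto simp: L_def)
    qed
    moreover have "continuous_map X euclideanreal (f i)" if "i < n" for i using f that by simp
    ultimately obtain g where g: "\<And>i. i < n \<Longrightarrow> continuous_map X euclideanreal (g i)"
      "\<And>x i. x \<in> E \<Longrightarrow> i < n \<Longrightarrow> g i x = f i x" "\<And>x. x \<in> L \<Longrightarrow> \<exists>i<n. g i x \<noteq> 0"
      using rel_extD[OF Lext E, of f] by blast
    \<comment> \<open>\<open>Z\<close> misses \<open>L\<close>, so it meets \<open>W\<close> and
      \<open>U\<close> in the same set; this makes both \<open>Z \<inter> W\<close> and its
      complement \<open>Z - U\<close> in \<open>Z\<close> closed.\<close>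
    define Z where "Z = {x \<in> A. \<forall>i<n. g i x = 0}"
    have Z: "closedin X Z" unfolding Z_def using Suc.prems g by (intro closedin_zeros) auto
    have ZL: "Z \<inter> L = {}" using g(3) by (auto simp: Z_def)
    define P where "P = Z \<inter> W"
    define N where "N = Z - U"
    have P: "closedin X P" using Z closA[OF W] by (auto simp: P_def)
    have N: "closedin X N"
    proof -
      have "closedin X (A - U)" 
        using closA[OF closedin_diff[OF closedin_topspace[of ?S] U]] AX by (simp add: inf.absorb2)
      moreover have "N = Z \<inter> (A - U)" by (auto simp: N_def Z_def)
      ultimately show ?thesis using Z by auto
    qed
    have ZPN: "Z \<subseteq> P \<union> N" and PN: "P \<inter> N = {}" using ZL by (auto simp: P_def N_def L_def dest: subsetD[OF UW])
    have EZ: "E \<inter> Z \<subseteq> Z0" using g(2) by (auto simp: Z_def Z0_def)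
    have EP: "f n x > 0" if "x \<in> E \<inter> P" for x
    proof -
      have "x \<in> C \<union> D" using that EZ Z0CD by (auto simp: P_def)
      then show ?thesis using that WD Cpos by (auto simp: P_def)
    qed
    have EN: "f n x < 0" if "x \<in> E \<inter> N" for x
    proof -
      have "x \<in> C \<union> D" using that EZ Z0CD by (auto simp: N_def)
      then show ?thesis using that CU Dneg by (auto simp: N_def)
    qed
    \<comment> \<open>Open half-lines as targets keep \<open>p\<close> and \<open>q\<close> nonzero
      on all of \<open>X\<close>. On \<open>E \<inter> P\<close> and \<open>E \<inter> N\<close>
      they agree with \<open>f n\<close>, by the signs just found, which makes the gluing below
      possible.\<close>
    obtain p where p: "continuous_map X euclideanreal p" "p ` topspace X \<subseteq> {0<..}" "\<And>x. x \<in> E \<inter> P \<Longrightarrow> p x = f n x"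
    proof (rule Tietze_extension_realinterval[OF norm closedin_Int[OF E P], of "{0<..}" "f n"])
      show "f n ` (E \<inter> P) \<subseteq> {0<..}" using EP by auto
    qed (use continuous_map_from_subtopology[OF fn] in \<open>auto simp: is_interval_convex_1\<close>)
    obtain q where q: "continuous_map X euclideanreal q" "q ` topspace X \<subseteq> {..<0}" "\<And>x. x \<in> E \<inter> N \<Longrightarrow> q x = f n x"
    proof (rule Tietze_extension_realinterval[OF norm closedin_Int[OF E N], of "{..<0}" "f n"])
      show "f n ` (E \<inter> N) \<subseteq> {..<0}" using EN by auto
    qed (use continuous_map_from_subtopology[OF fn] in \<open>auto simp: is_interval_convex_1\<close>)
    obtain h1 where h1: "continuous_map X euclideanreal h1" "\<And>x. x \<in> E \<Longrightarrow> h1 x = f n x" "\<And>x. x \<in> P \<Longrightarrow> h1 x = p x"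
      using continuous_map_glue[OF norm E P fn p(1)] p(3) by (metis IntI)
    have "h1 x = q x" if "x \<in> E \<union> P" "x \<in> N" for x
      using that PN h1(2) q(3) by auto
    then obtain h where h: "continuous_map X euclideanreal h" "\<And>x. x \<in> E \<union> P \<Longrightarrow> h x = h1 x" "\<And>x. x \<in> N \<Longrightarrow> h x = q x"
      using continuous_map_glue[OF norm closedin_Un[OF E P] N h1(1) q(1)] by metis
    have hZ: "h x \<noteq> 0" if "x \<in> Z" for x
    proof -
      have "x \<in> topspace X" using that AX by (auto simp: Z_def)
      then have "p x > 0" "q x < 0" using p(2) q(2) by auto
      moreover have "x \<in> P \<or> x \<in> N" using that ZPN by auto
      ultimately show ?thesis using h(2,3) h1(3) by force
    qed
    define G where "G = (\<lambda>i. if i < n then g i else h)"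
    have "\<forall>i<Suc n. continuous_map X euclideanreal (G i)" using g h by (auto simp: G_def)
    moreover have "\<forall>x\<in>E. \<forall>i<Suc n. G i x = f i x"
      using g h h1 by (auto simp: G_def less_Suc_eq)
    moreover have "\<forall>x\<in>A. \<exists>i<Suc n. G i x \<noteq> 0"
    proof
      fix x assume "x \<in> A"
      show "\<exists>i<Suc n. G i x \<noteq> 0"
      proof (cases "x \<in> Z")
        case True then show ?thesis using hZ by (intro exI[of _ n]) (auto simp: G_def)
      next
        case False
        then obtain i where "i < n" "g i x \<noteq> 0" using \<open>x \<in> A\<close> by (auto simp: Z_def)
        then show ?thesis by (intro exI[of _ i]) (auto simp: G_def)
      qed
    qed
    ultimately show "\<exists>g. (\<forall>i<Suc n. continuous_map X euclideanreal (g i)) \<and> (\<forall>x\<in>E. \<forall>i<Suc n. g i x = f i x) \<and>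
           (\<forall>x\<in>A. \<exists>i<Suc n. g i x \<noteq> 0)" by blast
  qed
qed

text \<open>The trace on \<open>A\<close> of a neighbourhood \<open>V\<close> has its relative
  frontier inside the frontier of \<open>V\<close>, so the induction hypothesis for subspaces of
  that frontier applies.\<close>

lemma ind_le_subtopology: "ind_le n X \<Longrightarrow> ind_le n (subtopology X A)"
proof (induction n arbitrary: X A)
  case (Suc n)
  show ?case
    unfolding ind_le.simps
  proof (intro ballI allI impI, elim conjE)
    fix x U assume x: "x \<in> topspace (subtopology X A)" and U: "openin (subtopology X A) U" "x \<in> U"
    then obtain U' where U': "openin X U'" "U = U' \<inter> A" by (auto simp: openin_subtopology)
    have xU': "x \<in> topspace X" "x \<in> U'" using x U U' by auto
    have "\<exists>V. closedin X V \<and> x \<in> X interior_of V \<and> V \<subseteq> U' \<and> ind_le n (subtopology X (X frontier_of V))"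
      using Suc.prems[unfolded ind_le.simps, rule_format, OF xU'(1), of U'] U' xU' by blast
    then obtain V where V: "closedin X V" "x \<in> X interior_of V" "V \<subseteq> U'" "ind_le n (subtopology X (X frontier_of V))"
      by blast
    let ?S = "subtopology X A"
    let ?V = "V \<inter> A"
    have "x \<in> ?S interior_of ?V"
      using V(2) x unfolding interior_of_def
      by (auto simp: openin_subtopology)
    moreover have "?S frontier_of ?V \<subseteq> X frontier_of V \<inter> A"
    proof -
      have cl: "closedin ?S ?V" using V(1) by (auto simp: closedin_subtopology)
      have "A \<inter> X interior_of V \<subseteq> ?S interior_of ?V"
        by (rule interior_of_maximal) (use interior_of_subset[of X V] in \<open>auto simp: openin_subtopology_Int2\<close>)
      then show ?thesis using cl V(1) by (auto simp: frontier_of_def closure_of_closedin)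
    qed
    then have "subtopology ?S (?S frontier_of ?V) = subtopology (subtopology X (X frontier_of V)) (?S frontier_of ?V)"
      by (simp add: subtopology_subtopology) (metis inf.absorb2 le_inf_iff)
    then have "ind_le n (subtopology ?S (?S frontier_of ?V))"
      using Suc.IH[OF V(4)] by simp
    ultimately show "\<exists>V. closedin ?S V \<and> x \<in> ?S interior_of V \<and> V \<subseteq> U \<and> ind_le n (subtopology ?S (?S frontier_of V))"
      using V U' by (intro exI[of _ ?V]) (auto simp: closedin_subtopology)
  qed
qed auto

section \<open>Dimension of null spaces\<close>

text \<open>The diameter of \<open>B\<close> in the sup-pseudometric of \<open>\<Phi>\<close> is at
  most \<open>r\<close>. The bound is a separate number because covers carry their sizes along;
  \<open>0 \<le> r\<close> has to be said for empty \<open>B\<close> or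
  \<open>\<Phi>\<close>.\<close>

definition osc_le :: "('a \<Rightarrow> real) set \<Rightarrow> 'a set \<Rightarrow> real \<Rightarrow> bool" where
  "osc_le \<Phi> B r \<longleftrightarrow> 0 \<le> r \<and> (\<forall>y\<in>B. \<forall>z\<in>B. \<forall>\<phi>\<in>\<Phi>. \<bar>\<phi> y - \<phi> z\<bar> \<le> r)"

text \<open>Since \<open>0 ^ 0 = 1\<close>, for \<open>s = 0\<close> this counts the nonempty sets of the cover.\<close>
definition cover_cost :: "nat \<Rightarrow> (nat \<Rightarrow> 'a set) \<Rightarrow> (nat \<Rightarrow> real) \<Rightarrow> ennreal" where
  "cover_cost s B r = (suminf (\<lambda>i. if B i = {} then 0 else ennreal (r i ^ s)))"

text \<open>Vanishing Hausdorff content: the sizes of the pieces are unrestricted. This amounts to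
  vanishing Hausdorff measure, since a small total cost forces small pieces.\<close>

definition hnull :: "('a \<Rightarrow> real) set \<Rightarrow> nat \<Rightarrow> 'a set \<Rightarrow> bool" where
  "hnull \<Phi> s A \<longleftrightarrow> (\<forall>e>0. \<exists>B r. A \<subseteq> (\<Union>i. B i) \<and> (\<forall>i. osc_le \<Phi> (B i) (r i)) \<and> cover_cost s B r < e)"

lemma hnullD:
  assumes "hnull \<Phi> s A" "0 < e"
  obtains B r where "A \<subseteq> (\<Union>i. B i)" "\<And>i. osc_le \<Phi> (B i) (r i)" "cover_cost s B r < e"
  using assms unfolding hnull_def by metis

lemma hnull_subset: "hnull \<Phi> s A \<Longrightarrow> B \<subseteq> A \<Longrightarrow> hnull \<Phi> s B"
  unfolding hnull_def by (meson order_trans)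

text \<open>Each nonempty member costs 1 at exponent 0, so a cover of cost below 1 has none. This is
  the base of the induction on dimension.\<close>

lemma hnull_0: assumes "hnull \<Phi> 0 A" shows "A = {}"
proof -
  obtain B r where B: "A \<subseteq> (\<Union>i. B i)" "cover_cost 0 B r < 1"
    using hnullD[OF assms zero_less_one] by metis
  have "B i = {}" for i
  proof (rule ccontr)
    assume "B i \<noteq> {}"
    then have "(1::ennreal) = (if B i = {} then 0 else ennreal (r i ^ 0))" by simp
    also have "\<dots> \<le> cover_cost 0 B r"
      using sum_le_suminf[of "\<lambda>i. if B i = {} then 0 else ennreal (r i ^ 0)" "{i}"]
      by (simp add: cover_cost_def)
    finally show False using B(2) by auto
  qed
  then show ?thesis using B by auto
qed

lemma ennreal_pos_real_below:
  fixes e :: ennreal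
  assumes "0 < e"
  obtains e' :: real where "0 < e'" "ennreal e' < e"
proof -
  obtain x where x: "0 < x" "x < e" using dense[OF assms] by blast
  then obtain r where "x = ennreal r" "0 \<le> r" by (cases x) auto
  with x that show thesis by (auto simp: ennreal_less_zero_iff)
qed

lemma hnull_UN:
  assumes null: "\<And>n. hnull \<Phi> s (A n)"
  shows "hnull \<Phi> s (\<Union>n::nat. A n)"
  unfolding hnull_def
proof (intro allI impI)
  fix e :: ennreal assume "0 < e"
  then obtain e' :: real where e': "0 < e'" "ennreal e' < e" by (rule ennreal_pos_real_below)
  have "\<exists>B r. A n \<subseteq> (\<Union>i. B i) \<and> (\<forall>i. osc_le \<Phi> (B i) (r i)) \<and> cover_cost s B r < ennreal (e' * (1/2) ^ Suc n)" for n
    using null[of n] e' unfolding hnull_def by simp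
  then obtain B r where B: "\<And>n. A n \<subseteq> (\<Union>i. B n i)" "\<And>n i. osc_le \<Phi> (B n i) (r n i)"
    "\<And>n. cover_cost s (B n) (r n) < ennreal (e' * (1/2) ^ Suc n)" by metis
  \<comment> \<open>All covers are enumerated as a single sequence; their costs add up to less than
    the geometric series with sum \<open>e'\<close>.\<close>
  let ?B = "\<lambda>k. case prod_decode k of (n, i) \<Rightarrow> B n i"
  let ?r = "\<lambda>k. case prod_decode k of (n, i) \<Rightarrow> r n i"
  have "(\<Union>n. A n) \<subseteq> (\<Union>k. ?B k)"
  proof
    fix x assume "x \<in> (\<Union>n. A n)"
    then obtain n i where "x \<in> B n i" using B(1) by blast
    then have "x \<in> ?B (prod_encode (n, i))" by simp
    then show "x \<in> (\<Union>k. ?B k)" by (rule UN_I[OF UNIV_I])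
  qed
  moreover have "osc_le \<Phi> (?B k) (?r k)" for k using B(2) by (auto split: prod.split)
  moreover have "cover_cost s ?B ?r < e"
  proof -
    let ?f = "\<lambda>p. if B (fst p) (snd p) = {} then 0 else ennreal (r (fst p) (snd p) ^ s)"
    have "cover_cost s ?B ?r = (suminf (\<lambda>k. ?f (prod_decode k)))"
      unfolding cover_cost_def by (intro suminf_cong) (simp add: case_prod_beta)
    also have "\<dots> = (suminf (\<lambda>n. cover_cost s (B n) (r n)))"
      by (rule suminf_ennreal_2dimen) (simp add: cover_cost_def cong: if_cong)
    also have "\<dots> \<le> (suminf (\<lambda>n. ennreal (e' * (1/2) ^ Suc n)))"
      by (intro suminf_le summableI) (rule less_imp_le[OF B(3)])
    also have "\<dots> = ennreal (suminf (\<lambda>n. e' * (1/2) ^ Suc n))"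
      using e' by (intro suminf_ennreal2 summable_mult sums_summable[OF power_half_series]) auto
    also have "(suminf (\<lambda>n. e' * (1/2) ^ Suc n)) = e'"
      using sums_unique[OF sums_mult[OF power_half_series, of e']] by simp
    finally show ?thesis using e' by simp
  qed
  ultimately show "\<exists>B r. (\<Union>n. A n) \<subseteq> (\<Union>i. B i) \<and> (\<forall>i. osc_le \<Phi> (B i) (r i)) \<and> cover_cost s B r < e"
    by (intro exI[of _ ?B] exI[of _ ?r] conjI allI)
qed

lemma hnull_countable_Union:
  fixes \<A> :: "'a set set"
  assumes "countable \<A>" "\<And>A. A \<in> \<A> \<Longrightarrow> hnull \<Phi> s A"
  shows "hnull \<Phi> s (\<Union>\<A>)"
proof (cases "\<A> = {}")
  case True
  have "cover_cost s (\<lambda>i. {}::'a set) (\<lambda>i. 0) = 0" by (simp add: cover_cost_def)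
  then show ?thesis unfolding True hnull_def 
    by (intro allI impI exI[of _ "\<lambda>i. {}"] exI[of _ "\<lambda>i. 0"]) (simp add: osc_le_def)
next
  case False
  then have "\<Union>\<A> = (\<Union>n. from_nat_into \<A> n)" using assms(1) by (metis range_from_nat_into)
  then show ?thesis using hnull_UN assms(2) from_nat_into[OF False] by metis
qed

lemma hnull_finite_covers:
  assumes "\<And>e. 0 < e \<Longrightarrow> \<exists>\<B> r. finite \<B> \<and> A \<subseteq> \<Union>\<B> \<and> (\<forall>B\<in>\<B>. osc_le \<Phi> B r) \<and> 0 \<le> r \<and> real (card \<B>) * r ^ s < e"
  shows "hnull \<Phi> s A"
  unfolding hnull_def
proof (intro allI impI)
  fix e :: ennreal assume "0 < e"
  then obtain e' :: real where e': "0 < e'" "ennreal e' < e" by (rule ennreal_pos_real_below)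
  obtain \<B> r where \<B>: "finite \<B>" "A \<subseteq> \<Union>\<B>" "\<And>B. B \<in> \<B> \<Longrightarrow> osc_le \<Phi> B r" "0 \<le> r" "real (card \<B>) * r ^ s < e'"
    using assms[OF e'(1)] by metis
  obtain f where f: "bij_betw f {..<card \<B>} \<B>"
    using ex_bij_betw_nat_finite[OF \<B>(1)] by (auto simp: atLeast0LessThan)
  let ?B = "\<lambda>i. if i < card \<B> then f i else {}"
  have "A \<subseteq> (\<Union>i. ?B i)"
  proof
    fix x assume "x \<in> A"
    then obtain i where "i < card \<B>" "x \<in> f i" using \<B>(2) bij_betw_imp_surj_on[OF f] by blast
    then have "x \<in> ?B i" by simp
    then show "x \<in> (\<Union>i. ?B i)" by (rule UN_I[OF UNIV_I])
  qed
  moreover have "osc_le \<Phi> (?B i) r" for i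
    using \<B>(3)[of "f i"] \<B>(4) bij_betwE[OF f] by (auto simp: osc_le_def)
  moreover have "cover_cost s ?B (\<lambda>_. r) < e"
  proof -
    have "cover_cost s ?B (\<lambda>_. r) = (\<Sum>i<card \<B>. if ?B i = {} then 0 else ennreal (r ^ s))"
      unfolding cover_cost_def by (intro suminf_finite) auto
    also have "\<dots> \<le> (\<Sum>i<card \<B>. ennreal (r ^ s))" by (intro sum_mono) auto
    also have "\<dots> = ennreal (real (card \<B>) * r ^ s)"
      using \<B>(4) by (simp add: ennreal_mult'' ennreal_of_nat_eq_real_of_nat)
    also have "\<dots> \<le> ennreal e'" using \<B>(5) by (intro ennreal_leI) auto
    finally show ?thesis using e' by simp
  qed
  ultimately show "\<exists>B r. A \<subseteq> (\<Union>i. B i) \<and> (\<forall>i. osc_le \<Phi> (B i) (r i)) \<and> cover_cost s B r < e"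
    by (intro exI[of _ ?B] exI[of _ "\<lambda>_. r"] conjI allI)
qed

text \<open>As in Eilenberg's inequality, the covering costs of the levels integrate to at most a multiple of
  the covering cost of \<open>A\<close>.\<close>
lemma hnull_levels:
  assumes null: "hnull \<Phi> (Suc s) A" and L: "0 \<le> L"
    and g: "\<And>B r y z. osc_le \<Phi> B r \<Longrightarrow> y \<in> B \<Longrightarrow> z \<in> B \<Longrightarrow> \<bar>g y - g z\<bar> \<le> L * r"
  shows "AE t in lborel. hnull \<Phi> s {y \<in> A. g y = t}"
proof -
  \<comment> \<open>Summable costs make the sum over \<open>n\<close> of the functions
    \<open>h n\<close> below integrable, hence finite at almost every \<open>t\<close>.\<close>
  have "\<exists>B r. A \<subseteq> (\<Union>i. B i) \<and> (\<forall>i. osc_le \<Phi> (B i) (r i)) \<and> cover_cost (Suc s) B r < ennreal ((1/2) ^ Suc n)" for n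
    using null unfolding hnull_def by simp
  then obtain B r where B: "\<And>n. A \<subseteq> (\<Union>i. B n i)" "\<And>n i. osc_le \<Phi> (B n i) (r n i)"
    "\<And>n. cover_cost (Suc s) (B n) (r n) < ennreal ((1/2) ^ Suc n)" by metis
  define b where "b = (\<lambda>n i. SOME x. x \<in> B n i)"
  have r0: "0 \<le> r n i" for n i using B(2) by (simp add: osc_le_def)
  have b: "b n i \<in> B n i" if "B n i \<noteq> {}" for n i
    using that by (auto simp: b_def intro: someI_ex)
  \<comment> \<open>\<open>g\<close> maps \<open>B n i\<close> into this interval, and its length
    \<open>2 * L * r n i\<close> absorbs one of the \<open>Suc s\<close> factors
    \<open>r n i\<close>. The sample \<open>b n i\<close> of an empty piece is arbitrary, but there
    the weight \<open>w\<close> is 0.\<close>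
  define J where "J = (\<lambda>n i. {g (b n i) - L * r n i .. g (b n i) + L * r n i})"
  define w where "w = (\<lambda>n i. if B n i = {} then 0 else ennreal (r n i ^ s))"
  define h where "h = (\<lambda>n t. suminf (\<lambda>i. w n i * indicator (J n i) t))"
  have h_meas[measurable]: "h n \<in> borel_measurable lborel" for n
    unfolding h_def J_def by measurable
  have int_h: "(\<integral>\<^sup>+t. h n t \<partial>lborel) \<le> ennreal (2 * L) * ennreal ((1/2) ^ Suc n)" for n
  proof -
    have "(\<integral>\<^sup>+t. h n t \<partial>lborel) = (suminf (\<lambda>i. \<integral>\<^sup>+t. w n i * indicator (J n i) t \<partial>lborel))"
      unfolding h_def J_def by (intro nn_integral_suminf) measurable
    also have "\<dots> = (suminf (\<lambda>i. w n i * ennreal (2 * L * r n i)))"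
      using L r0 by (intro suminf_cong) (simp add: J_def nn_integral_cmult mult.assoc)
    also have "\<dots> = (suminf (\<lambda>i. ennreal (2 * L) * (if B n i = {} then 0 else ennreal (r n i ^ Suc s))))"
      using L r0 by (intro suminf_cong) (auto simp: w_def ennreal_mult'[symmetric] ennreal_mult''[symmetric] mult_ac)
    also have "\<dots> = ennreal (2 * L) * cover_cost (Suc s) (B n) (r n)"
      unfolding cover_cost_def by simp
    also have "\<dots> \<le> ennreal (2 * L) * ennreal ((1/2) ^ Suc n)"
      using B(3)[of n] by (intro mult_left_mono) auto
    finally show ?thesis .
  qed
  have "(\<integral>\<^sup>+t. (suminf (\<lambda>n. h n t)) \<partial>lborel) = (suminf (\<lambda>n. \<integral>\<^sup>+t. h n t \<partial>lborel))"
    by (intro nn_integral_suminf) measurable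
  also have "\<dots> \<le> (suminf (\<lambda>n. ennreal (2 * L) * ennreal ((1/2) ^ Suc n)))"
    by (intro suminf_le summableI int_h)
  also have "\<dots> = ennreal (2 * L) * ennreal (suminf (\<lambda>n. (1/2) ^ Suc n))"
    using sums_summable[OF power_half_series] by (simp add: suminf_ennreal2 del: power_Suc)
  also have "\<dots> < \<infinity>" by (simp add: ennreal_mult_less_top)
  finally have "AE t in lborel. (suminf (\<lambda>n. h n t)) \<noteq> \<infinity>"
    by (intro nn_integral_PInf_AE) auto
  then show ?thesis
  proof (rule AE_mp, intro AE_I2 impI)
    fix t assume fin: "(suminf (\<lambda>n. h n t)) \<noteq> \<infinity>"
    show "hnull \<Phi> s {y \<in> A. g y = t}"
      unfolding hnull_def
    proof (intro allI impI)
      fix e :: ennreal assume "0 < e"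
      \<comment> \<open>The terms of a convergent series get below \<open>e\<close>. And
        \<open>h n t\<close> is the cost of the pieces of the \<open>n\<close>-th cover with
        \<open>t \<in> J n i\<close>, which cover the level set.\<close>
      have "\<exists>n. h n t < e"
      proof (rule ccontr)
        assume "\<not> ?thesis"
        then have he: "e \<le> h n t" for n by (auto simp: not_less)
        obtain c where c: "(suminf (\<lambda>n. h n t)) = ennreal c" "0 \<le> c" using fin by (metis ennreal_cases infinity_ennreal_def)
        obtain e' :: real where e': "0 < e'" "ennreal e' < e" using ennreal_pos_real_below[OF \<open>0 < e\<close>] .
        obtain m :: nat where m: "c < real m * e'" using reals_Archimedean3[OF e'(1)] by blast
        have "ennreal (real m * e') = (\<Sum>n<m. ennreal e')"
          using e' by (simp add: ennreal_mult'' ennreal_of_nat_eq_real_of_nat)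
        also have "\<dots> \<le> (\<Sum>n<m. h n t)" using he e'(2) by (intro sum_mono) (meson less_imp_le order_trans)
        also have "\<dots> \<le> ennreal c" unfolding c(1)[symmetric] by (intro sum_le_suminf) auto
        finally show False using m c(2) by (simp add: ennreal_le_iff)
      qed
      then obtain n where n: "h n t < e" ..
      let ?B = "\<lambda>i. if t \<in> J n i then B n i else {}"
      have "{y \<in> A. g y = t} \<subseteq> (\<Union>i. ?B i)"
      proof
        fix y assume y: "y \<in> {y \<in> A. g y = t}"
        then obtain i where i: "y \<in> B n i" using B(1) by blast
        then have "\<bar>g y - g (b n i)\<bar> \<le> L * r n i" using b[of n i] by (intro g[OF B(2)]) auto
        then have "t \<in> J n i" using y by (auto simp: J_def abs_le_iff)
        then show "y \<in> (\<Union>i. ?B i)" using i by auto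
      qed
      moreover have "osc_le \<Phi> (?B i) (r n i)" for i using B(2)[of n i] r0 by (auto simp: osc_le_def)
      moreover have "cover_cost s ?B (r n) = h n t"
        unfolding cover_cost_def h_def w_def by (intro suminf_cong) (auto simp: indicator_def)
      ultimately show "\<exists>B r. {y \<in> A. g y = t} \<subseteq> (\<Union>i. B i) \<and> (\<forall>i. osc_le \<Phi> (B i) (r i)) \<and> cover_cost s B r < e"
        using n by (intro exI[of _ ?B] exI[of _ "r n"] conjI allI) simp_all
    qed
  qed
qed

text \<open>The indices fit because \<open>ind_le n\<close> means dimension at most
  \<open>n - 1\<close>, and null in dimension 0 means empty. Finiteness of \<open>Q\<close> matters
  twice: it makes \<open>g\<close> continuous, and it bounds the oscillation of \<open>g\<close> by
  \<open>card Q\<close> times that of \<open>\<Phi>\<close>.\<close>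

theorem hnull_imp_ind_le:
  fixes X :: "'a topology"
  assumes cont: "\<And>\<phi>. \<phi> \<in> \<Phi> \<Longrightarrow> continuous_map X euclideanreal \<phi>"
    and base: "\<And>U x. openin X U \<Longrightarrow> x \<in> U \<Longrightarrow>
      \<exists>Q e. finite Q \<and> Q \<subseteq> \<Phi> \<and> 0 < e \<and> {y \<in> topspace X. \<forall>\<phi>\<in>Q. \<bar>\<phi> y - \<phi> x\<bar> < e} \<subseteq> U"
  shows "A \<subseteq> topspace X \<Longrightarrow> hnull \<Phi> n A \<Longrightarrow> ind_le n (subtopology X A)"
proof (induction n arbitrary: A)
  case 0
  then show ?case using hnull_0 by fastforce
next
  case (Suc n)
  let ?S = "subtopology X A"
  have tS: "topspace ?S = A" using Suc.prems by auto
  show ?case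
    unfolding ind_le.simps
  proof (intro ballI allI impI, elim conjE)
    fix x U assume "x \<in> topspace ?S" "openin ?S U" "x \<in> U"
    then obtain U' where U': "openin X U'" "U = U' \<inter> A" "x \<in> U'" "x \<in> A" by (auto simp: openin_subtopology)
    obtain Q e where Q: "finite Q" "Q \<subseteq> \<Phi>" "0 < e" "{y \<in> topspace X. \<forall>\<phi>\<in>Q. \<bar>\<phi> y - \<phi> x\<bar> < e} \<subseteq> U'"
      using base[OF U'(1,3)] by blast
    define g where "g = (\<lambda>y. \<Sum>\<phi>\<in>Q. \<bar>\<phi> y - \<phi> x\<bar>)"
    have gx: "g x = 0" by (simp add: g_def)
    have contg: "continuous_map ?S euclideanreal g"
      unfolding g_def using Q cont
      by (intro continuous_map_from_subtopology continuous_map_sum continuous_map_real_abs continuous_map_diff) auto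
    have gU: "y \<in> U" if "y \<in> A" "g y < e" for y
    proof -
      have "\<bar>\<phi> y - \<phi> x\<bar> < e" if "\<phi> \<in> Q" for \<phi>
        using member_le_sum[OF that, of "\<lambda>\<phi>. \<bar>\<phi> y - \<phi> x\<bar>"] Q(1) \<open>g y < e\<close> by (auto simp: g_def)
      then show ?thesis using Q(4) U' that Suc.prems by auto
    qed
    have gosc: "\<bar>g y - g z\<bar> \<le> real (card Q) * r" if "osc_le \<Phi> B r" "y \<in> B" "z \<in> B" for B r y z
    proof -
      have "\<bar>g y - g z\<bar> \<le> (\<Sum>\<phi>\<in>Q. \<bar>\<bar>\<phi> y - \<phi> x\<bar> - \<bar>\<phi> z - \<phi> x\<bar>\<bar>)"
        unfolding g_def sum_subtractf[symmetric] by (rule sum_abs)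
      also have "\<dots> \<le> (\<Sum>\<phi>\<in>Q. r)"
      proof (rule sum_mono)
        fix \<phi> assume "\<phi> \<in> Q"
        then have "\<bar>\<phi> y - \<phi> z\<bar> \<le> r" using that Q(2) by (auto simp: osc_le_def)
        then show "\<bar>\<bar>\<phi> y - \<phi> x\<bar> - \<bar>\<phi> z - \<phi> x\<bar>\<bar> \<le> r" by linarith
      qed
      finally show ?thesis by simp
    qed
    have "AE t in lborel. hnull \<Phi> n {y \<in> A. g y = t}"
      by (rule hnull_levels[OF Suc.prems(2) _ gosc]) auto
    \<comment> \<open>An interval of positive length meets the set of good levels. A level above 0
      puts \<open>x\<close> in the interior of the sublevel set, a level below \<open>e\<close>
      keeps that set inside \<open>U\<close>.\<close>
    moreover have "\<not> (AE t in lborel. t \<notin> {0<..<e})"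
    proof
      assume "AE t in lborel. t \<notin> {0<..<e}"
      then have "emeasure lborel {0<..<e} = 0" by (subst (asm) AE_iff_measurable[of "{0<..<e}"]) auto
      then show False using \<open>0 < e\<close> by simp
    qed
    ultimately obtain t where t: "t \<in> {0<..<e}" "hnull \<Phi> n {y \<in> A. g y = t}"
      by (metis (mono_tags, lifting) eventually_mono)
    let ?V = "{y \<in> topspace ?S. g y \<in> {..t}}"
    let ?O = "{y \<in> topspace ?S. g y \<in> {..<t}}"
    have V: "closedin ?S ?V" by (rule closedin_continuous_map_preimage[OF contg]) simp
    have O: "openin ?S ?O" by (rule openin_continuous_map_preimage[OF contg]) simp
    have OV: "?O \<subseteq> ?S interior_of ?V" by (rule interior_of_maximal[OF _ O]) auto
    have "?S frontier_of ?V \<subseteq> {y \<in> A. g y = t}"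
      using V OV by (auto simp: frontier_of_def closure_of_closedin)
    then have fr: "?S frontier_of ?V \<subseteq> A" "hnull \<Phi> n (?S frontier_of ?V)"
      using hnull_subset[OF t(2)] by auto
    then have sub: "subtopology ?S (?S frontier_of ?V) = subtopology X (?S frontier_of ?V)"
      by (simp only: subtopology_subtopology inf.absorb2)
    show "\<exists>V. closedin ?S V \<and> x \<in> ?S interior_of V \<and> V \<subseteq> U \<and> ind_le n (subtopology ?S (?S frontier_of V))"
    proof (intro exI[of _ ?V] conjI)
      show "x \<in> ?S interior_of ?V" by (rule subsetD[OF OV]) (use t gx U' \<open>x \<in> topspace ?S\<close> in auto)
      show "?V \<subseteq> U" using gU t tS by auto
      show "ind_le n (subtopology ?S (?S frontier_of ?V))" unfolding sub using fr Suc.prems(1) by (intro Suc.IH) auto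
    qed (rule V)
  qed
qed

section \<open>Generators of closed subgroups\<close>

text \<open>The index set is arbitrary because the inductions on the structure of subgroups delete
  single coordinates.\<close>

definition fin_vecs :: "nat set \<Rightarrow> (nat \<Rightarrow> real) set" where
  "fin_vecs I = {x. \<forall>i. i \<notin> I \<longrightarrow> x i = 0}"

definition norm1 :: "nat set \<Rightarrow> (nat \<Rightarrow> real) \<Rightarrow> real" where
  "norm1 I x = (\<Sum>i\<in>I. \<bar>x i\<bar>)"

definition lin_comb :: "nat set \<Rightarrow> (nat \<Rightarrow> nat \<Rightarrow> real) \<Rightarrow> (nat \<Rightarrow> real) \<Rightarrow> nat \<Rightarrow> real" where
  "lin_comb I w h = (\<lambda>i. \<Sum>j\<in>I. h j * w j i)"

definition add_subgroup :: "(nat \<Rightarrow> real) set \<Rightarrow> bool" where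
  "add_subgroup H \<longleftrightarrow> (\<lambda>i. 0) \<in> H \<and> (\<forall>x\<in>H. \<forall>y\<in>H. (\<lambda>i. x i + y i) \<in> H) \<and> (\<forall>x\<in>H. (\<lambda>i. - x i) \<in> H)"

text \<open>There is one generator per coordinate, whatever the rank of \<open>H\<close>: a
  coefficient group \<open>{0}\<close> switches a generator off. For coefficient groups the
  inequality also gives uniqueness of the admissible coefficients, with a quantitative
  bound.\<close>

definition coef_system :: "nat set \<Rightarrow> (nat \<Rightarrow> nat \<Rightarrow> real) \<Rightarrow> (nat \<Rightarrow> real set) \<Rightarrow> real \<Rightarrow> (nat \<Rightarrow> real) set \<Rightarrow> bool" where
  "coef_system I w G c H \<longleftrightarrow> 0 \<le> c \<and> H = lin_comb I w ` {h. \<forall>j\<in>I. h j \<in> G j} \<and>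
     (\<forall>h. (\<forall>j\<in>I. h j \<in> G j) \<longrightarrow> norm1 I h \<le> c * norm1 I (lin_comb I w h))"

lemma norm1_nonneg [simp]: "0 \<le> norm1 I x"
  by (simp add: norm1_def sum_nonneg)

lemma norm1_add: "norm1 I (\<lambda>i. x i + y i) \<le> norm1 I x + norm1 I y"
  unfolding norm1_def sum.distrib[symmetric] by (intro sum_mono) auto

lemma norm1_diff: "norm1 I (\<lambda>i. x i - y i) \<le> norm1 I x + norm1 I y"
  unfolding norm1_def sum.distrib[symmetric] by (intro sum_mono) auto

lemma norm1_scale: "norm1 I (\<lambda>i. t * x i) = \<bar>t\<bar> * norm1 I x"
  by (simp add: norm1_def abs_mult sum_distrib_left)

lemma norm1_mono: "finite J \<Longrightarrow> I \<subseteq> J \<Longrightarrow> norm1 I x \<le> norm1 J x"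
  unfolding norm1_def by (intro sum_mono2) auto

lemma norm1_ge: "finite I \<Longrightarrow> i \<in> I \<Longrightarrow> \<bar>x i\<bar> \<le> norm1 I x"
  unfolding norm1_def by (intro member_le_sum) auto

lemma add_subgroup_zero: "add_subgroup H \<Longrightarrow> (\<lambda>i. 0) \<in> H"
  by (simp add: add_subgroup_def)

lemma add_subgroup_add:
  assumes "add_subgroup H" "x \<in> H" "y \<in> H"
  shows "(\<lambda>i. x i + y i) \<in> H"
  using assms(1) unfolding add_subgroup_def by (elim conjE) (rule bspec[OF bspec[OF _ assms(2)] assms(3)])

lemma add_subgroup_minus:
  assumes "add_subgroup H" "x \<in> H"
  shows "(\<lambda>i. - x i) \<in> H"
  using assms(1) unfolding add_subgroup_def by (elim conjE) (rule bspec[OF _ assms(2)])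

lemma add_subgroup_diff:
  assumes "add_subgroup H" "x \<in> H" "y \<in> H"
  shows "(\<lambda>i. x i - y i) \<in> H"
  using add_subgroup_add[OF assms(1,2) add_subgroup_minus[OF assms(1,3)]] by simp

lemma add_subgroup_Ints:
  assumes H: "add_subgroup H" "x \<in> H" and t: "t \<in> \<int>"
  shows "(\<lambda>i. t * x i) \<in> H"
proof -
  have nat: "(\<lambda>i. real n * x i) \<in> H" for n
  proof (induction n)
    case 0 then show ?case using H by (simp add: add_subgroup_def)
  next
    case (Suc n)
    from add_subgroup_add[OF H(1) H(2) Suc] show ?case by (simp add: algebra_simps)
  qed
  from t obtain k where k: "t = of_int k" by (auto elim: Ints_cases)
  show ?thesis
  proof (cases "k \<ge> 0")
    case True
    then show ?thesis using nat[of "nat k"] k by simp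
  next
    case False
    then show ?thesis using add_subgroup_minus[OF H(1) nat[of "nat (-k)"]] k by simp
  qed
qed

lemma add_subgroup_lin_comb:
  assumes H: "add_subgroup H" and "finite J" "\<And>j. j \<in> J \<Longrightarrow> (\<lambda>i. h j * w j i) \<in> H"
  shows "lin_comb J w h \<in> H"
  using assms(2,3)
proof (induction J rule: finite_induct)
  case empty
  then show ?case using H by (simp add: lin_comb_def add_subgroup_def)
next
  case (insert j J)
  then have "(\<lambda>i. h j * w j i) \<in> H" "lin_comb J w h \<in> H" by auto
  from add_subgroup_add[OF H this] show ?case using insert by (simp add: lin_comb_def)
qed

lemma lin_comb_insert:
  "finite J \<Longrightarrow> p \<notin> J \<Longrightarrow> lin_comb (insert p J) (w(p := v)) h = (\<lambda>i. lin_comb J w h i + h p * v i)"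
  unfolding lin_comb_def by (auto simp: add.commute intro!: ext sum.cong)

lemma norm1_insert: "finite J \<Longrightarrow> p \<notin> J \<Longrightarrow> norm1 (insert p J) x = \<bar>x p\<bar> + norm1 J x"
  by (simp add: norm1_def)

lemma lin_comb_fun_upd: "p \<notin> J \<Longrightarrow> lin_comb J w (h(p := t)) = lin_comb J w h"
  unfolding lin_comb_def by (intro ext sum.cong) auto

text \<open>Induction on the coordinates. If \<open>x p\<close> vanishes on \<open>H\<close>, the
  coordinate is dropped. Otherwise a primitive vector \<open>v\<close> with
  \<open>v p \<noteq> 0\<close> is split off: the projection along \<open>v\<close> kills coordinate
  \<open>p\<close>, its image is discrete again, and generators of the image are lifted to
  \<open>H\<close>.\<close>

lemma discrete_subgroup_coef_system:
  assumes "finite I" "add_subgroup H" "H \<subseteq> fin_vecs I" "\<And>B. finite {x \<in> H. norm1 I x \<le> B}"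
  shows "\<exists>w G c. (\<forall>j. G j \<in> {\<int>, {0}}) \<and> coef_system I w G c H"
  using assms
proof (induction I arbitrary: H rule: finite_induct)
  case empty
  then have "H = {\<lambda>i. 0}" by (auto simp: fin_vecs_def add_subgroup_def)
  then show ?case
    by (intro exI[of _ "\<lambda>_ _. 0"] exI[of _ "\<lambda>_. {0}"] exI[of _ 0]) (auto simp: coef_system_def lin_comb_def norm1_def)
next
  case (insert p I)
  note H = insert.prems(1)
  let ?I = "insert p I"
  show ?case
  proof (cases "\<forall>x\<in>H. x p = 0")
    case True
    have "H \<subseteq> fin_vecs I"
    proof
      fix x assume "x \<in> H"
      then have "x p = 0" "x \<in> fin_vecs ?I" using True insert.prems(2) by auto
      then have "x i = 0" if "i \<notin> I" for i using that by (cases "i = p") (auto simp: fin_vecs_def)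
      then show "x \<in> fin_vecs I" by (simp add: fin_vecs_def)
    qed
    moreover have "finite {x \<in> H. norm1 I x \<le> B}" for B
    proof -
      have "{x \<in> H. norm1 I x \<le> B} = {x \<in> H. norm1 ?I x \<le> B}"
        using True insert.hyps by (auto simp: norm1_insert)
      then show ?thesis using insert.prems(3) by simp
    qed
    ultimately obtain w G c where w: "\<forall>j. G j \<in> {\<int>, {0}}" "coef_system I w G c H"
      using insert.IH[OF H] by blast
    have eq: "lin_comb ?I (w(p := \<lambda>i. 0)) h = lin_comb I w h" for h
      using insert.hyps by (simp add: lin_comb_insert)
    have "coef_system ?I (w(p := \<lambda>i. 0)) (G(p := {0})) c H"
      unfolding coef_system_def eq
    proof (intro conjI allI impI)
      show "0 \<le> c" using w by (simp add: coef_system_def)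
      show "H = lin_comb I w ` {h. \<forall>j\<in>?I. h j \<in> (G(p := {0})) j}"
      proof (intro equalityI subsetI)
        fix x assume "x \<in> H"
        then obtain h where h: "x = lin_comb I w h" "\<forall>j\<in>I. h j \<in> G j" using w by (auto simp: coef_system_def)
        then have "x = lin_comb I w (h(p := 0))" using insert.hyps by (simp add: lin_comb_fun_upd)
        then show "x \<in> lin_comb I w ` {h. \<forall>j\<in>?I. h j \<in> (G(p := {0})) j}"
          by (rule image_eqI[of _ _ "h(p := 0)"]) (use h insert.hyps in auto)
      next
        fix x assume "x \<in> lin_comb I w ` {h. \<forall>j\<in>?I. h j \<in> (G(p := {0})) j}"
        then obtain h where "x = lin_comb I w h" "\<forall>j\<in>?I. h j \<in> (G(p := {0})) j" by auto
        moreover from this(2) have "\<forall>j\<in>I. h j \<in> G j" using insert.hyps by (auto split: if_splits)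
        ultimately show "x \<in> H" using w by (auto simp: coef_system_def)
      qed
      fix h assume h: "\<forall>j\<in>?I. h j \<in> (G(p := {0})) j"
      then have "\<forall>j\<in>I. h j \<in> G j" using insert.hyps by (auto split: if_splits)
      then have "norm1 I h \<le> c * norm1 I (lin_comb I w h)" "lin_comb I w h \<in> H" using w by (auto simp: coef_system_def)
      then show "norm1 ?I h \<le> c * norm1 ?I (lin_comb I w h)"
        using h bspec[OF True, of "lin_comb I w h"] insert.hyps by (simp add: norm1_insert)
    qed
    moreover have "\<forall>j. (G(p := {0})) j \<in> {\<int>, {0}}" using w by simp
    ultimately show ?thesis by (intro exI conjI)
  next
    case False
    then obtain v0 where v0: "v0 \<in> H" "v0 p \<noteq> 0" by auto
    \<comment> \<open>A shortest nonzero element of \<open>H\<close> on the line through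
      \<open>v0\<close>. The length bound makes the set of candidates finite.\<close>
    define L where "L = {x \<in> {x \<in> H. norm1 ?I x \<le> norm1 ?I v0}. x p \<noteq> 0 \<and> (\<exists>t. x = (\<lambda>i. t * v0 i))}"
    have fI: "finite ?I" using insert.hyps by simp
    have "finite L" unfolding L_def using insert.prems(3) by (rule finite_subset[rotated]) auto
    moreover have "v0 \<in> L" using v0 by (auto simp: L_def intro: exI[of _ 1])
    ultimately obtain v where v: "v \<in> L" "\<And>x. x \<in> L \<Longrightarrow> norm1 ?I v \<le> norm1 ?I x"
      using arg_min_if_finite(1)[of L "norm1 ?I"] arg_min_least[of L _ "norm1 ?I"] by (metis empty_iff)
    have vp: "v p \<noteq> 0" and vH: "v \<in> H" using v by (auto simp: L_def)
    have npos: "0 < norm1 ?I v" using norm1_ge[OF fI, of p v] vp by auto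
    \<comment> \<open>Otherwise the fractional part of \<open>t\<close> would give a shorter element
      on the same line.\<close>
    have vZ: "t \<in> \<int>" if "(\<lambda>i. t * v i) \<in> H" for t
    proof (rule ccontr)
      assume t: "t \<notin> \<int>"
      have f: "0 < frac t" "frac t < 1" using t frac_lt_1 frac_gt_0_iff by auto
      have "(\<lambda>i. real_of_int \<lfloor>t\<rfloor> * v i) \<in> H" by (rule add_subgroup_Ints[OF H vH]) simp
      from add_subgroup_diff[OF H that this] have "(\<lambda>i. frac t * v i) \<in> H"
        by (simp add: frac_def left_diff_distrib)
      moreover have n: "norm1 ?I (\<lambda>i. frac t * v i) < norm1 ?I v"
        using f npos by (simp add: norm1_scale)
      moreover obtain s where "v = (\<lambda>i. s * v0 i)" using v by (auto simp: L_def)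
      then have "\<exists>s. (\<lambda>i. frac t * v i) = (\<lambda>i. s * v0 i)" by (intro exI[of _ "frac t * s"]) auto
      ultimately have "(\<lambda>i. frac t * v i) \<in> L" using v(1) f vp by (auto simp: L_def)
      with v(2) n show False by fastforce
    qed
    \<comment> \<open>Projection along \<open>v\<close> onto the hyperplane where coordinate
      \<open>p\<close> is 0.\<close>
    define \<pi> where "\<pi> = (\<lambda>x i. x i - (x p / v p) * v i)"
    have pip: "\<pi> x p = 0" for x using vp by (simp add: \<pi>_def)
    have pin: "norm1 ?I (\<pi> x) = norm1 I (\<pi> x)" for x using insert.hyps pip by (simp add: norm1_insert)
    have pi_add: "\<pi> (\<lambda>i. x i + y i) = (\<lambda>i. \<pi> x i + \<pi> y i)" for x y
      by (auto simp: \<pi>_def field_simps add_divide_distrib)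
    have pi_minus: "\<pi> (\<lambda>i. - x i) = (\<lambda>i. - \<pi> x i)" for x by (auto simp: \<pi>_def)
    have pi_lc: "\<pi> (lin_comb I u h) = lin_comb I (\<lambda>j. \<pi> (u j)) h" for u h
      unfolding \<pi>_def lin_comb_def
      by (auto simp: sum_subtractf sum_distrib_right sum_divide_distrib right_diff_distrib intro!: ext sum.cong)
    define H' where "H' = \<pi> ` H"
    have "add_subgroup H'"
      unfolding add_subgroup_def H'_def
    proof (intro conjI ballI)
      have "(\<lambda>i. 0) = \<pi> (\<lambda>i. 0)" by (simp add: \<pi>_def)
      then show "(\<lambda>i. 0) \<in> \<pi> ` H" using add_subgroup_zero[OF H] by (rule image_eqI)
      fix x assume "x \<in> \<pi> ` H"
      then obtain x' where x': "x' \<in> H" "x = \<pi> x'" by auto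
      have "(\<lambda>i. - x i) = \<pi> (\<lambda>i. - x' i)" using x' by (simp add: pi_minus)
      then show "(\<lambda>i. - x i) \<in> \<pi> ` H" using add_subgroup_minus[OF H x'(1)] by (rule image_eqI)
      fix y assume "y \<in> \<pi> ` H"
      then obtain y' where y': "y' \<in> H" "y = \<pi> y'" by auto
      have "(\<lambda>i. x i + y i) = \<pi> (\<lambda>i. x' i + y' i)" using x' y' by (simp add: pi_add)
      then show "(\<lambda>i. x i + y i) \<in> \<pi> ` H" using add_subgroup_add[OF H x'(1) y'(1)] by (rule image_eqI)
    qed
    moreover have "H' \<subseteq> fin_vecs I"
    proof
      fix y assume "y \<in> H'"
      then obtain x where x: "x \<in> H" "y = \<pi> x" by (auto simp: H'_def)
      have "\<pi> x i = 0" if "i \<notin> I" for i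
      proof (cases "i = p")
        case False
        moreover have "x \<in> fin_vecs ?I" "v \<in> fin_vecs ?I" using x vH insert.prems(2) by auto
        ultimately have "x i = 0" "v i = 0" using that by (simp_all add: fin_vecs_def)
        then show ?thesis by (simp add: \<pi>_def)
      qed (simp add: pip)
      then show "y \<in> fin_vecs I" using x by (simp add: fin_vecs_def)
    qed
    moreover have "finite {y \<in> H'. norm1 I y \<le> B}" for B
    \<comment> \<open>Discreteness of the image: subtracting an integer multiple of \<open>v\<close>
      from a preimage leaves its projection unchanged and brings it within \<open>norm1 ?I v\<close>
      of that projection.\<close>
    proof (rule finite_subset[of _ "\<pi> ` {x \<in> H. norm1 ?I x \<le> B + norm1 ?I v}"])
      show "{y \<in> H'. norm1 I y \<le> B} \<subseteq> \<pi> ` {x \<in> H. norm1 ?I x \<le> B + norm1 ?I v}"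
      proof
        fix y assume "y \<in> {y \<in> H'. norm1 I y \<le> B}"
        then obtain x where x: "x \<in> H" "y = \<pi> x" "norm1 I (\<pi> x) \<le> B" by (auto simp: H'_def)
        define t where "t = x p / v p"
        define z where "z = (\<lambda>i. x i - real_of_int \<lfloor>t\<rfloor> * v i)"
        have zH: "z \<in> H" unfolding z_def
          by (rule add_subgroup_diff[OF H x(1) add_subgroup_Ints[OF H vH]]) simp
        have z: "z = (\<lambda>i. \<pi> x i + frac t * v i)"
          by (simp add: z_def \<pi>_def t_def frac_def algebra_simps)
        have "norm1 ?I z \<le> norm1 ?I (\<pi> x) + norm1 ?I (\<lambda>i. frac t * v i)" unfolding z by (rule norm1_add)
        also have "\<dots> \<le> B + norm1 ?I v"
          using x(3) npos frac_lt_1[of t] frac_ge_0[of t] by (intro add_mono) (auto simp: pin norm1_scale mult_left_le_one_le)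
        finally have "norm1 ?I z \<le> B + norm1 ?I v" .
        moreover have "\<pi> z = y"
          using vp x(2) by (auto simp: \<pi>_def z_def diff_divide_distrib algebra_simps)
        ultimately show "y \<in> \<pi> ` {x \<in> H. norm1 ?I x \<le> B + norm1 ?I v}" using zH by (intro image_eqI[of _ _ z]) simp_all
      qed
    qed (use insert.prems(3) in auto)
    ultimately have "\<exists>w G c. (\<forall>j. G j \<in> {\<int>, {0}}) \<and> coef_system I w G c H'"
      by (rule insert.IH)
    then obtain w' G' c' where w': "\<forall>j. G' j \<in> {\<int>, {0}}" "coef_system I w' G' c' H'"
      by (elim exE conjE)
    \<comment> \<open>A lift of \<open>w' j\<close> to \<open>H\<close> exists if coefficient 1 is
      admissible. For the coefficient group \<open>{0}\<close> any element of \<open>H\<close> will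
      do, which is why the equation carries the factor \<open>a\<close>.\<close>
    have "\<exists>u\<in>H. \<forall>a\<in>G' j. \<forall>i. a * \<pi> u i = a * w' j i" if j: "j \<in> I" for j
    proof (cases "G' j = {0}")
      case True
      then show ?thesis using vH by auto
    next
      case False
      then have G: "G' j = \<int>" using w' by auto
      define h :: "nat \<Rightarrow> real" where "h = (\<lambda>k. if k = j then 1 else 0)"
      have "\<forall>k\<in>I. h k \<in> G' k" 
      proof
        fix k show "h k \<in> G' k" using w'(1)[rule_format, of k] G by (auto simp: h_def)
      qed
      then have "lin_comb I w' h \<in> H'" using w'(2) by (auto simp: coef_system_def)
      moreover have "lin_comb I w' h = w' j"
        using j insert.hyps by (auto simp: lin_comb_def h_def if_distrib[of "\<lambda>x. x * _"] cong: if_cong)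
      ultimately show ?thesis unfolding H'_def by (metis imageE)
    qed
    then obtain u where u: "\<And>j. j \<in> I \<Longrightarrow> u j \<in> H" "\<And>j a i. j \<in> I \<Longrightarrow> a \<in> G' j \<Longrightarrow> a * \<pi> (u j) i = a * w' j i"
      by metis
    define w where "w = u(p := v)"
    define G where "G = G'(p := \<int>)"
    have lc: "lin_comb ?I w h = (\<lambda>i. lin_comb I u h i + h p * v i)" for h
      unfolding w_def using insert.hyps by (intro lin_comb_insert)
    have GG: "(\<forall>j\<in>?I. h j \<in> G j) \<longleftrightarrow> h p \<in> \<int> \<and> (\<forall>j\<in>I. h j \<in> G' j)" for h
      using insert.hyps by (auto simp: G_def)
    have uH: "lin_comb I u h \<in> H" if "\<forall>j\<in>I. h j \<in> G' j" for h
    proof (rule add_subgroup_lin_comb[OF H insert.hyps(1)])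
      fix j assume "j \<in> I"
      then have "h j \<in> \<int>" using that w'(1)[rule_format, of j] by auto
      then show "(\<lambda>i. h j * u j i) \<in> H" using add_subgroup_Ints[OF H u(1)] \<open>j \<in> I\<close> by auto
    qed
    have pu: "\<pi> (lin_comb I u h) = lin_comb I w' h" if "\<forall>j\<in>I. h j \<in> G' j" for h
      unfolding pi_lc unfolding lin_comb_def using u(2) that by (intro ext sum.cong) auto
    have wH: "lin_comb ?I w h \<in> H" if "\<forall>j\<in>?I. h j \<in> G j" for h
      unfolding lc using that GG uH add_subgroup_Ints[OF H vH] by (intro add_subgroup_add[OF H]) auto
    have "H = lin_comb ?I w ` {h. \<forall>j\<in>?I. h j \<in> G j}"
    proof (intro equalityI subsetI)
      fix x assume x: "x \<in> H"
      then have "\<pi> x \<in> H'" by (auto simp: H'_def)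
      then obtain h where h: "\<forall>j\<in>I. h j \<in> G' j" "\<pi> x = lin_comb I w' h" using w'(2) by (auto simp: coef_system_def)
      define y where "y = (\<lambda>i. x i - lin_comb I u h i)"
      define t where "t = y p / v p"
      have yH: "y \<in> H" unfolding y_def by (rule add_subgroup_diff[OF H x uH[OF h(1)]])
      have "\<pi> y i = \<pi> x i - \<pi> (lin_comb I u h) i" for i
        by (simp add: \<pi>_def y_def diff_divide_distrib left_diff_distrib)
      then have "\<pi> y i = 0" for i by (simp only: h(2) pu[OF h(1)] diff_self)
      then have yi: "y i = t * v i" for i unfolding \<pi>_def t_def by (rule iffD1[OF right_minus_eq])
      then have "y = (\<lambda>i. t * v i)" by (rule ext)
      with yH have "t \<in> \<int>" by (intro vZ) simp
      moreover have "x = lin_comb ?I w (h(p := t))"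
        unfolding lc lin_comb_fun_upd[OF insert.hyps(2)] fun_upd_same yi[symmetric] by (simp add: y_def)
      ultimately show "x \<in> lin_comb ?I w ` {h. \<forall>j\<in>?I. h j \<in> G j}"
        using h(1) insert.hyps by (intro image_eqI[of _ _ "h(p := t)"]) (auto simp: G_def)
    qed (use wH in auto)
    \<comment> \<open>\<open>\<pi>\<close> has norm at most
      \<open>1 + norm1 ?I v / \<bar>v p\<bar>\<close>, so \<open>C\<close> bounds the coefficients
      on \<open>I\<close>. The coefficient at \<open>p\<close> is then found from coordinate
      \<open>p\<close>, to which the lifted generators contribute at most \<open>m\<close> times the
      others; hence \<open>c\<close>.\<close>
    moreover define C where "C = c' * (1 + norm1 ?I v / \<bar>v p\<bar>)"
    define m where "m = (\<Sum>j\<in>I. \<bar>u j p\<bar>)"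
    define c where "c = (1 + C * m) / \<bar>v p\<bar> + C"
    have c'0: "0 \<le> c'" using w'(2) by (simp add: coef_system_def)
    have C0: "0 \<le> C" and m0: "0 \<le> m" using c'0 by (auto simp: C_def m_def sum_nonneg)
    have "norm1 ?I h \<le> c * norm1 ?I (lin_comb ?I w h)" if "\<forall>j\<in>?I. h j \<in> G j" for h
    proof -
      define x where "x = lin_comb ?I w h"
      have h: "\<forall>j\<in>I. h j \<in> G' j" using that GG by blast
      have xp: "\<bar>x p\<bar> \<le> norm1 ?I x" by (rule norm1_ge[OF fI]) simp
      have "\<pi> x i = \<pi> (lin_comb I u h) i" for i
        unfolding x_def lc using vp by (simp add: \<pi>_def add_divide_distrib algebra_simps)
      then have "\<pi> x = lin_comb I w' h" using pu[OF h] by auto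
      then have nc: "norm1 I h \<le> c' * norm1 I (\<pi> x)" using w'(2) h by (auto simp: coef_system_def)
      have "norm1 I (\<pi> x) \<le> norm1 ?I x + norm1 ?I (\<lambda>i. (x p / v p) * v i)"
        unfolding pin[symmetric] unfolding \<pi>_def by (rule norm1_diff)
      also have "\<dots> \<le> norm1 ?I x + norm1 ?I x * (norm1 ?I v / \<bar>v p\<bar>)"
        using xp vp mult_right_mono[OF xp, of "norm1 ?I v / \<bar>v p\<bar>"] unfolding norm1_scale by (simp add: abs_divide)
      finally have "c' * norm1 I (\<pi> x) \<le> c' * (norm1 ?I x + norm1 ?I x * (norm1 ?I v / \<bar>v p\<bar>))"
        using c'0 by (rule mult_left_mono)
      with nc have nh: "norm1 I h \<le> C * norm1 ?I x" by (simp add: C_def algebra_simps)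
      have "h p * v p = x p - (\<Sum>j\<in>I. h j * u j p)"
        unfolding x_def lc by (simp add: lin_comb_def)
      then have "\<bar>h p\<bar> * \<bar>v p\<bar> \<le> \<bar>x p\<bar> + \<bar>\<Sum>j\<in>I. h j * u j p\<bar>" by (simp add: abs_mult[symmetric])
      also have "\<bar>\<Sum>j\<in>I. h j * u j p\<bar> \<le> (\<Sum>j\<in>I. norm1 I h * \<bar>u j p\<bar>)"
        using norm1_ge[OF insert.hyps(1)] by (intro order_trans[OF sum_abs] sum_mono) (auto simp: abs_mult intro: mult_right_mono)
      also have "\<dots> = norm1 I h * m" by (simp add: m_def sum_distrib_left)
      also have "\<dots> \<le> (C * norm1 ?I x) * m" using nh m0 by (rule mult_right_mono)
      finally have "\<bar>h p\<bar> * \<bar>v p\<bar> \<le> (1 + C * m) * norm1 ?I x" using xp by (simp add: algebra_simps)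
      then have "\<bar>h p\<bar> \<le> (1 + C * m) / \<bar>v p\<bar> * norm1 ?I x" using vp by (simp add: field_simps)
      with nh show ?thesis using insert.hyps unfolding x_def[symmetric] by (simp add: norm1_insert c_def algebra_simps)
    qed
    moreover have "0 \<le> c" using C0 m0 by (simp add: c_def)
    ultimately have "coef_system ?I w G c H" unfolding coef_system_def by (intro conjI allI impI)
    moreover have "\<forall>j. G j \<in> {\<int>, {0}}" using w'(1) by (simp add: G_def)
    ultimately show ?thesis by (intro exI conjI)
  qed
qed

section \<open>Non-discrete closed subgroups\<close>

lemma tendsto_fun_iff:
  fixes f :: "'b \<Rightarrow> 'i \<Rightarrow> 'a::topological_space"
  shows "(f \<longlongrightarrow> l) F \<longleftrightarrow> (\<forall>i. ((\<lambda>x. f x i) \<longlongrightarrow> l i) F)"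
  unfolding limitin_canonical_iff[symmetric] euclidean_product_topology[symmetric] limitin_componentwise
  by simp

lemma compact_box:
  fixes I :: "'i set" and B :: real
  shows "compact {x. \<forall>i. (i \<in> I \<longrightarrow> \<bar>x i\<bar> \<le> B) \<and> (i \<notin> I \<longrightarrow> x i = 0)}"
proof -
  let ?S = "\<lambda>i. if i \<in> I then {-B..B} else {0}"
  have "{x. \<forall>i. (i \<in> I \<longrightarrow> \<bar>x i\<bar> \<le> B) \<and> (i \<notin> I \<longrightarrow> x i = 0)} = PiE UNIV ?S" (is "?l = _")
    by (auto simp: PiE_def Pi_def abs_le_iff minus_le_iff split: if_splits)
  moreover have "compactin (product_topology (\<lambda>i. euclideanreal) UNIV) (PiE UNIV ?S)"
    by (simp add: compactin_PiE)
  ultimately show ?thesis by (simp add: euclidean_product_topology)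
qed

lemma norm1_pos:
  assumes "finite I" "x \<in> fin_vecs I" "x \<noteq> (\<lambda>i. 0)"
  shows "0 < norm1 I x"
proof -
  obtain i where i: "x i \<noteq> 0" using assms(3) by auto
  then have "i \<in> I" using assms(2) by (auto simp: fin_vecs_def)
  then show ?thesis using norm1_ge[OF assms(1), of i x] i by auto
qed

lemma tendsto_norm1: 
  assumes "finite I" "(f \<longlongrightarrow> l) F" shows "((\<lambda>n. norm1 I (f n)) \<longlongrightarrow> norm1 I l) F"
  using assms(2) unfolding norm1_def tendsto_fun_iff by (intro tendsto_sum tendsto_rabs) auto

text \<open>Points of \<open>H\<close> accumulating at \<open>0\<close> have directions accumulating at some \<open>u\<close>, and integer
  multiples of them approximate every multiple of \<open>u\<close>.\<close>
lemma closed_subgroup_line: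
  assumes I: "finite I" and H: "add_subgroup H" "closed H" "H \<subseteq> fin_vecs I"
    and B: "infinite {x \<in> H. norm1 I x \<le> B}"
  shows "\<exists>u\<in>fin_vecs I. u \<noteq> (\<lambda>i. 0) \<and> (\<forall>t. (\<lambda>i. t * u i) \<in> H)"
proof -
  let ?K = "\<lambda>B. {x. \<forall>i. (i \<in> I \<longrightarrow> \<bar>x i\<bar> \<le> B) \<and> (i \<notin> I \<longrightarrow> x i = (0::real))}"
  have inK: "x \<in> ?K B" if "x \<in> fin_vecs I" "norm1 I x \<le> B" for x B
    using that norm1_ge[OF I, of _ x] by (force simp: fin_vecs_def)
  have KS: "?K B \<subseteq> fin_vecs I" for B by (auto simp: fin_vecs_def)
  have "{x \<in> H. norm1 I x \<le> B} \<subseteq> ?K B" using inK H(3) by blast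
  then obtain l where l: "l islimpt {x \<in> H. norm1 I x \<le> B}"
    using compact_box[of I B] B unfolding compact_eq_Bolzano_Weierstrass by blast
  then obtain f where f: "\<And>n. f n \<in> {x \<in> H. norm1 I x \<le> B} - {l}" "f \<longlonglongrightarrow> l"
    unfolding islimpt_sequential by blast
  have "l \<in> H" using f closed_sequentially[OF H(2), of f] by auto
  \<comment> \<open>Closedness puts the limit point \<open>l\<close> into \<open>H\<close>, so these
    differences are nonzero elements of \<open>H\<close> that tend to 0.\<close>
  define h where "h = (\<lambda>n i. f n i - l i)"
  have hH: "h n \<in> H" for n
    unfolding h_def using f(1)[of n] \<open>l \<in> H\<close> by (intro add_subgroup_diff[OF H(1)]) auto
  have h0: "h n \<noteq> (\<lambda>i. 0)" for n
  proof
    assume "h n = (\<lambda>i. 0)"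
    then have "f n i = l i" for i unfolding h_def by (metis eq_iff_diff_eq_0)
    then have "f n = l" by auto
    then show False using f(1)[of n] by auto
  qed
  have "h \<longlonglongrightarrow> (\<lambda>i. 0)"
    using f(2) unfolding tendsto_fun_iff h_def by (auto intro: tendsto_eq_intros)
  then have hn: "(\<lambda>n. norm1 I (h n)) \<longlonglongrightarrow> 0" using tendsto_norm1[OF I, of h "\<lambda>i. 0" sequentially] by (simp add: norm1_def)
  have npos: "0 < norm1 I (h n)" for n using norm1_pos[OF I _ h0] hH H(3) by blast
  define u where "u = (\<lambda>n i. inverse (norm1 I (h n)) * h n i)"
  have un: "norm1 I (u n) = 1" for n unfolding u_def norm1_scale using npos[of n] by simp
  have uf: "u n \<in> fin_vecs I" for n using hH[of n] H(3) by (auto simp: u_def fin_vecs_def)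
  have "\<forall>n. u n \<in> ?K 1" by (intro allI inK[OF uf]) (simp add: un)
  then obtain v r where v: "v \<in> ?K 1" "strict_mono r" "(u \<circ> r) \<longlonglongrightarrow> v"
    by (rule seq_compactE[OF compact_imp_seq_compact[OF compact_box[of I 1]]])
  have "norm1 I v = 1"
    using LIMSEQ_unique[OF tendsto_norm1[OF I v(3)]] un by simp
  then have v0: "v \<noteq> (\<lambda>i. 0)" by (intro notI) (simp add: norm1_def)
  have "(\<lambda>i. t * v i) \<in> H" for t
  proof -
    \<comment> \<open>Integer multiples of ever shorter vectors: the length \<open>e n\<close> of
      the multiple misses \<open>t\<close> by at most \<open>norm1 I (h (r n))\<close>, and the
      directions converge to \<open>v\<close>.\<close>
    define m where "m = (\<lambda>n. real_of_int \<lfloor>t / norm1 I (h (r n))\<rfloor>)"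
    define e where "e = (\<lambda>n. m n * norm1 I (h (r n)))"
    have hr: "(\<lambda>n. norm1 I (h (r n))) \<longlonglongrightarrow> 0" using LIMSEQ_subseq_LIMSEQ[OF hn v(2)] by (simp add: o_def)
    have "\<bar>e n - t\<bar> \<le> norm1 I (h (r n))" for n
    proof -
      have "\<bar>m n - t / norm1 I (h (r n))\<bar> \<le> 1" unfolding m_def by linarith
      then have "\<bar>m n - t / norm1 I (h (r n))\<bar> * norm1 I (h (r n)) \<le> 1 * norm1 I (h (r n))" using npos by (intro mult_right_mono) auto
      moreover have "\<bar>m n - t / norm1 I (h (r n))\<bar> * norm1 I (h (r n)) = \<bar>(m n - t / norm1 I (h (r n))) * norm1 I (h (r n))\<bar>"
        by (simp add: abs_mult)
      moreover have "(m n - t / norm1 I (h (r n))) * norm1 I (h (r n)) = e n - t"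
        using npos[of "r n"] by (simp add: e_def left_diff_distrib)
      ultimately show ?thesis by simp
    qed
    then have "(\<lambda>n. e n - t) \<longlonglongrightarrow> 0" by (intro Lim_null_comparison[OF _ hr] always_eventually) auto
    then have e: "e \<longlonglongrightarrow> t" by (simp add: LIM_zero_iff)
    have "(\<lambda>n i. m n * h (r n) i) \<longlonglongrightarrow> (\<lambda>i. t * v i)"
      unfolding tendsto_fun_iff
    proof
      fix i
      have "(\<lambda>n. e n * u (r n) i) \<longlonglongrightarrow> t * v i"
        using v(3) e unfolding tendsto_fun_iff o_def by (intro tendsto_mult) auto
      moreover have "e n * u (r n) i = m n * h (r n) i" for n
        using npos[of "r n"] by (simp add: e_def u_def)
      ultimately show "(\<lambda>n. m n * h (r n) i) \<longlonglongrightarrow> t * v i" by simp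
    qed
    moreover have "(\<lambda>i. m n * h (r n) i) \<in> H" for n
      using hH by (intro add_subgroup_Ints[OF H(1)]) (auto simp: m_def)
    ultimately show ?thesis using closed_sequentially[OF H(2)] by fast
  qed
  moreover have "v \<in> fin_vecs I" using v(1) KS by blast
  ultimately show ?thesis using v0 by blast
qed

lemma continuous_on_coordinate: "continuous_on UNIV (\<lambda>x::'i \<Rightarrow> real. x q)"
  by (rule continuous_on_product_coordinates)

text \<open>If some ball contains infinitely many points of \<open>H\<close>, then \<open>H\<close>
  contains a line, and it is the sum of this line and of its intersection with a coordinate
  hyperplane transversal to the line. Such lines are split off until the discrete case is
  reached.\<close>

theorem closed_subgroup_coef_system:
  assumes "finite I" "add_subgroup H" "closed H" "H \<subseteq> fin_vecs I"
  shows "\<exists>w G c. (\<forall>j. G j \<in> {UNIV, \<int>, {0}}) \<and> coef_system I w G c H"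
  using assms
proof (induction I arbitrary: H rule: finite_psubset_induct)
  case (psubset I)
  note H = psubset.prems(1)
  show ?case
  proof (cases "\<forall>B. finite {x \<in> H. norm1 I x \<le> B}")
    case True
    then have "\<exists>w G c. (\<forall>j. G j \<in> {\<int>, {0}}) \<and> coef_system I w G c H"
      using psubset by (intro discrete_subgroup_coef_system) auto
    then show ?thesis by (elim exE conjE) (intro exI conjI, auto)
  next
    case False
    then obtain v where v: "v \<in> fin_vecs I" "v \<noteq> (\<lambda>i. 0)" "\<And>t. (\<lambda>i. t * v i) \<in> H"
      using closed_subgroup_line[OF psubset.hyps psubset.prems] by blast
    then obtain q where q: "v q \<noteq> 0" by auto
    have qI: "q \<in> I" using q v(1) by (auto simp: fin_vecs_def)
    let ?J = "I - {q}"
    have IJ: "insert q ?J = I" and finJ: "finite ?J" and qJ: "q \<notin> ?J" using qI psubset.hyps by auto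
    \<comment> \<open>Since the whole line of \<open>v\<close> is in \<open>H\<close>, sliding along
      \<open>v\<close> moves every element into the hyperplane without leaving \<open>H\<close>. So
      an intersection can replace the projection of the discrete case, and closedness is
      inherited.\<close>
    define H' where "H' = H \<inter> {x. x q = 0}"
    have "add_subgroup H'"
      unfolding add_subgroup_def H'_def
      using add_subgroup_zero[OF H] add_subgroup_add[OF H] add_subgroup_minus[OF H] by simp
    moreover have "closed H'"
      unfolding H'_def using closed_Collect_eq[OF continuous_on_coordinate[of q] continuous_on_const[of UNIV 0]] psubset.prems by auto
    moreover have "H' \<subseteq> fin_vecs ?J"
    proof
      fix x assume "x \<in> H'"
      then have x: "x \<in> fin_vecs I" "x q = 0" using psubset.prems by (auto simp: H'_def)
      then have "x i = 0" if "i \<notin> ?J" for i using that by (cases "i = q") (auto simp: fin_vecs_def)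
      then show "x \<in> fin_vecs ?J" by (simp add: fin_vecs_def)
    qed
    moreover have "?J \<subset> I" using qI by auto
    ultimately have "\<exists>w G c. (\<forall>j. G j \<in> {UNIV, \<int>, {0}}) \<and> coef_system ?J w G c H'"
      using psubset.IH by simp
    then obtain w' G' c' where w': "\<forall>j. G' j \<in> {UNIV, \<int>, {0}}" "coef_system ?J w' G' c' H'"
      by (elim exE conjE)
    have c'0: "0 \<le> c'" using w'(2) by (simp add: coef_system_def)
    define w where "w = w'(q := v)"
    define G where "G = G'(q := UNIV)"
    have lc: "lin_comb I w h = (\<lambda>i. lin_comb ?J w' h i + h q * v i)" for h
      unfolding w_def using lin_comb_insert[OF finJ qJ, of w' v h] IJ by simp
    have GJ: "(\<forall>j\<in>I. h j \<in> G j) \<longleftrightarrow> (\<forall>j\<in>?J. h j \<in> G' j)" for h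
      by (auto simp: G_def)
    have inH': "lin_comb ?J w' h \<in> H'" if "\<forall>j\<in>?J. h j \<in> G' j" for h using w'(2) that unfolding coef_system_def by auto
    have "H = lin_comb I w ` {h. \<forall>j\<in>I. h j \<in> G j}"
    proof (intro equalityI subsetI)
      fix x assume x: "x \<in> H"
      define t where "t = x q / v q"
      define y where "y = (\<lambda>i. x i - t * v i)"
      have "y \<in> H" unfolding y_def by (rule add_subgroup_diff[OF H x v(3)])
      moreover have "y q = 0" using q by (simp add: y_def t_def)
      ultimately have "y \<in> H'" by (simp add: H'_def)
      then obtain h where h: "\<forall>j\<in>?J. h j \<in> G' j" "y = lin_comb ?J w' h" using w'(2) by (auto simp: coef_system_def)
      have "x = lin_comb I w (h(q := t))"
        unfolding lc lin_comb_fun_upd[OF qJ] fun_upd_same h(2)[symmetric] by (simp add: y_def)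
      moreover have "\<forall>j\<in>I. (h(q := t)) j \<in> G j" using h(1) unfolding GJ by auto
      ultimately show "x \<in> lin_comb I w ` {h. \<forall>j\<in>I. h j \<in> G j}" by (intro image_eqI[of _ _ "h(q := t)"]) auto
    next
      fix x assume "x \<in> lin_comb I w ` {h. \<forall>j\<in>I. h j \<in> G j}"
      then obtain h where h: "x = lin_comb I w h" "\<forall>j\<in>?J. h j \<in> G' j" unfolding GJ by auto
      have "lin_comb ?J w' h \<in> H" using inH'[OF h(2)] by (simp add: H'_def)
      from add_subgroup_add[OF H this v(3)] show "x \<in> H" unfolding h(1) lc .
    qed
    \<comment> \<open>As \<open>y q = 0\<close>, the coefficient of \<open>v\<close> is
      \<open>x q / v q\<close>, at most \<open>norm1 I x / \<bar>v q\<bar>\<close>; subtracting that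
      multiple of \<open>v\<close> enlarges the norm by the factor in \<open>C\<close> at
      most.\<close>
    moreover define C where "C = c' * (1 + norm1 I v / \<bar>v q\<bar>)"
    define c where "c = 1 / \<bar>v q\<bar> + C"
    have "norm1 I h \<le> c * norm1 I (lin_comb I w h)" if "\<forall>j\<in>I. h j \<in> G j" for h
    proof -
      define x where "x = lin_comb I w h"
      define y where "y = lin_comb ?J w' h"
      have h: "\<forall>j\<in>?J. h j \<in> G' j" using that unfolding GJ .
      have "y q = 0" using inH'[OF h] by (simp add: H'_def y_def)
      then have xq: "x q = h q * v q" by (simp add: x_def lc y_def)
      have "\<bar>x q\<bar> \<le> norm1 I x" by (rule norm1_ge[OF psubset.hyps qI])
      then have hq: "\<bar>h q\<bar> \<le> norm1 I x / \<bar>v q\<bar>" using q by (simp add: xq abs_mult field_simps)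
      have yx: "y = (\<lambda>i. x i - h q * v i)" by (simp add: x_def lc y_def)
      have "norm1 ?J y \<le> norm1 I y" using psubset.hyps by (intro norm1_mono) auto
      also have "\<dots> \<le> norm1 I x + norm1 I (\<lambda>i. h q * v i)" unfolding yx by (rule norm1_diff)
      also have "\<dots> \<le> norm1 I x + norm1 I x / \<bar>v q\<bar> * norm1 I v"
        unfolding norm1_scale using hq by (intro add_mono mult_right_mono) auto
      finally have "c' * norm1 ?J y \<le> c' * (norm1 I x + norm1 I x / \<bar>v q\<bar> * norm1 I v)"
        using c'0 by (rule mult_left_mono)
      moreover have "norm1 ?J h \<le> c' * norm1 ?J y" using w'(2) h by (auto simp: coef_system_def y_def)
      ultimately have "norm1 ?J h \<le> C * norm1 I x" by (simp add: C_def algebra_simps)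
      moreover have "norm1 I h = \<bar>h q\<bar> + norm1 ?J h" using norm1_insert[OF finJ qJ, of h] IJ by simp
      ultimately show ?thesis using hq unfolding x_def[symmetric] by (simp add: c_def algebra_simps)
    qed
    moreover have "0 \<le> c" using c'0 by (simp add: c_def C_def)
    ultimately have "coef_system I w G c H" unfolding coef_system_def by (intro conjI allI impI)
    moreover have "\<forall>j. G j \<in> {UNIV, \<int>, {0}}" using w'(1) by (simp add: G_def)
    ultimately show ?thesis by (intro exI conjI)
  qed
qed

section \<open>The Chabauty topology and distances\<close>

lemma topspace_Euclidean_space_fin_vecs: "topspace (Euclidean_space d) = fin_vecs {..<d}"
  by (simp add: topspace_Euclidean_space fin_vecs_def not_less)

lemma closed_subgroups_iff:
  "H \<in> closed_subgroups d \<longleftrightarrow> closed H \<and> H \<subseteq> fin_vecs {..<d} \<and> add_subgroup H"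
  by (auto simp: closed_subgroups_def closedin_Euclidean_space_iff topspace_Euclidean_space_fin_vecs add_subgroup_def)

lemma Euclidean_space_top_of_set: "Euclidean_space d = top_of_set (fin_vecs {..<d})"
  unfolding Euclidean_space_def euclidean_product_topology by (simp add: fin_vecs_def not_less)

lemma continuous_on_norm1_diff: "continuous_on S (\<lambda>y. norm1 {..<d} (\<lambda>i. q i - y i))"
  unfolding norm1_def
  by (intro continuous_on_sum continuous_on_rabs continuous_on_diff continuous_on_const
      continuous_on_subset[OF continuous_on_coordinate]) auto

lemma openin_norm1_ball: "openin (Euclidean_space d) {y \<in> fin_vecs {..<d}. norm1 {..<d} (\<lambda>i. q i - y i) < a}"
proof -
  have "open {y. norm1 {..<d} (\<lambda>i. q i - y i) < a}"
    by (intro open_Collect_less continuous_on_norm1_diff continuous_on_const)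
  then show ?thesis unfolding Euclidean_space_top_of_set openin_open by auto
qed

lemma compactin_norm1_cball: "compactin (Euclidean_space d) {y \<in> fin_vecs {..<d}. norm1 {..<d} (\<lambda>i. q i - y i) \<le> a}"
proof -
  let ?B = "{x. \<forall>i. (i \<in> {..<d} \<longrightarrow> \<bar>x i\<bar> \<le> a + norm1 {..<d} q) \<and> (i \<notin> {..<d} \<longrightarrow> x i = (0::real))}"
  have "closed {y. norm1 {..<d} (\<lambda>i. q i - y i) \<le> a}"
    by (intro closed_Collect_le continuous_on_norm1_diff continuous_on_const)
  then have "compact (?B \<inter> {y. norm1 {..<d} (\<lambda>i. q i - y i) \<le> a})"
    by (intro compact_Int_closed compact_box)
  moreover have "?B \<inter> {y. norm1 {..<d} (\<lambda>i. q i - y i) \<le> a} = {y \<in> fin_vecs {..<d}. norm1 {..<d} (\<lambda>i. q i - y i) \<le> a}"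
  proof -
    have "\<bar>y i\<bar> \<le> a + norm1 {..<d} q" if "norm1 {..<d} (\<lambda>i. q i - y i) \<le> a" "i < d" for y i
      using norm1_ge[of "{..<d}" i q] norm1_ge[of "{..<d}" i "\<lambda>i. q i - y i"] that by auto
    then show ?thesis by (auto simp: fin_vecs_def)
  qed
  ultimately show ?thesis unfolding Euclidean_space_top_of_set compactin_subtopology by auto
qed

lemma openin_Euclidean_space_norm1:
  assumes U: "openin (Euclidean_space d) U" and x: "x \<in> U"
  shows "\<exists>e>0. \<forall>y\<in>fin_vecs {..<d}. norm1 {..<d} (\<lambda>i. x i - y i) < e \<longrightarrow> y \<in> U"
proof (rule ccontr)
  assume neg: "\<not> ?thesis"
  have "\<exists>y. y \<in> fin_vecs {..<d} \<and> norm1 {..<d} (\<lambda>i. x i - y i) < inverse (real (Suc n)) \<and> y \<notin> U" for n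
  proof -
    have "0 < inverse (real (Suc n))" by simp
    with neg show ?thesis by blast
  qed
  then obtain f where f: "\<And>n. f n \<in> fin_vecs {..<d}" "\<And>n. norm1 {..<d} (\<lambda>i. x i - f n i) < inverse (real (Suc n))" "\<And>n. f n \<notin> U"
    by metis
  have xF: "x \<in> fin_vecs {..<d}" using openin_subset[OF U] x topspace_Euclidean_space_fin_vecs by auto
  obtain T where T: "open T" "U = fin_vecs {..<d} \<inter> T"
    using U unfolding Euclidean_space_top_of_set openin_open by auto
  have "f \<longlonglongrightarrow> x"
    unfolding tendsto_fun_iff
  proof
    fix i
    show "(\<lambda>n. f n i) \<longlonglongrightarrow> x i"
    proof (cases "i < d")
      case True
      have "\<bar>f n i - x i\<bar> \<le> inverse (real (Suc n))" for n
        using norm1_ge[of "{..<d}" i "\<lambda>i. x i - f n i"] f(2)[of n] True by (simp add: abs_minus_commute)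
      then have "(\<lambda>n. f n i - x i) \<longlonglongrightarrow> 0"
        by (intro Lim_null_comparison[OF _ LIMSEQ_inverse_real_of_nat] always_eventually) auto
      then show ?thesis by (simp add: LIM_zero_iff)
    next
      case False
      then have "f n i = x i" for n using f(1)[of n] xF by (simp add: fin_vecs_def)
      then show ?thesis by simp
    qed
  qed
  then have "eventually (\<lambda>n. f n \<in> T) sequentially" using T x by (intro topological_tendstoD) auto
  then obtain n where "f n \<in> T" using eventually_happens by fastforce
  then show False using f T by auto
qed

section \<open>Distances generate the Chabauty topology on subgroups\<close>

definition dist1 :: "nat \<Rightarrow> (nat \<Rightarrow> real) \<Rightarrow> (nat \<Rightarrow> real) set \<Rightarrow> real" where
  "dist1 d q F = (INF y\<in>F. norm1 {..<d} (\<lambda>i. q i - y i))"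

lemma dist1_le: "y \<in> F \<Longrightarrow> dist1 d q F \<le> norm1 {..<d} (\<lambda>i. q i - y i)"
  unfolding dist1_def by (intro cINF_lower) (auto intro!: bdd_belowI[of _ 0])

lemma dist1_ge: "F \<noteq> {} \<Longrightarrow> (\<And>y. y \<in> F \<Longrightarrow> a \<le> norm1 {..<d} (\<lambda>i. q i - y i)) \<Longrightarrow> a \<le> dist1 d q F"
  unfolding dist1_def by (intro cINF_greatest)

lemma dist1_less: "F \<noteq> {} \<Longrightarrow> dist1 d q F < a \<longleftrightarrow> (\<exists>y\<in>F. norm1 {..<d} (\<lambda>i. q i - y i) < a)"
  by (metis dist1_ge dist1_le le_less_trans not_less)

lemma dist1_self: "x \<in> F \<Longrightarrow> dist1 d x F = 0"
  using dist1_le[of x F d x] dist1_ge[of F 0 d x] by (fastforce simp: norm1_def)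

lemma dist1_pos:
  assumes F: "F \<in> closed_subgroups d" and x: "x \<in> fin_vecs {..<d}" "x \<notin> F"
  shows "0 < dist1 d x F"
proof -
  have cl: "closedin (Euclidean_space d) F" using F by (simp add: closed_subgroups_def)
  have "openin (Euclidean_space d) (fin_vecs {..<d} - F)"
    using openin_diff[OF openin_topspace cl] by (simp add: topspace_Euclidean_space_fin_vecs)
  then obtain e where e: "e > 0" "\<forall>y\<in>fin_vecs {..<d}. norm1 {..<d} (\<lambda>i. x i - y i) < e \<longrightarrow> y \<in> fin_vecs {..<d} - F"
    using openin_Euclidean_space_norm1[of d "fin_vecs {..<d} - F" x] x by auto
  have ne: "F \<noteq> {}" using F by (auto simp: closed_subgroups_def)
  have Fv: "F \<subseteq> fin_vecs {..<d}" using F closed_subgroups_iff by blast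
  have "e \<le> dist1 d x F" using e(2) Fv by (intro dist1_ge ne) (meson DiffD2 not_less subsetD)
  then show ?thesis using e by simp
qed

lemma closed_subgroups_nonempty: "F \<in> closed_subgroups d \<Longrightarrow> F \<noteq> {}"
  by (auto simp: closed_subgroups_def)

lemma topspace_Sub_space: "topspace (Sub_space d) = closed_subgroups d"
proof -
  let ?E = "Euclidean_space d"
  \<comment> \<open>Missing the empty compact set is no condition, so the family of all closed sets
    is itself subbasic.\<close>
  have "{F. closedin ?E F \<and> F \<inter> {} = {}} \<in> {{F. closedin ?E F \<and> F \<inter> K = {}} |K. compactin ?E K}"
    by (rule CollectI, rule exI[of _ "{}"]) auto
  then have "{F. closedin ?E F} \<subseteq> topspace (chabauty_topology ?E)"
    unfolding chabauty_topology_def topology_generated_by_topspace by auto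
  then show ?thesis by (auto simp: Sub_space_def closed_subgroups_def)
qed

lemma openin_Sub_space_hit:
  assumes "openin (Euclidean_space d) U"
  shows "openin (Sub_space d) {F \<in> closed_subgroups d. F \<inter> U \<noteq> {}}"
proof -
  have "openin (chabauty_topology (Euclidean_space d)) {F. closedin (Euclidean_space d) F \<and> F \<inter> U \<noteq> {}}"
    unfolding chabauty_topology_def using assms by (intro topology_generated_by_Basis) auto
  moreover have "{F \<in> closed_subgroups d. F \<inter> U \<noteq> {}} =
      {F. closedin (Euclidean_space d) F \<and> F \<inter> U \<noteq> {}} \<inter> closed_subgroups d"
    by (auto simp: closed_subgroups_def)
  ultimately show ?thesis unfolding Sub_space_def openin_subtopology by blast
qed

lemma openin_Sub_space_miss:
  assumes "compactin (Euclidean_space d) K"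
  shows "openin (Sub_space d) {F \<in> closed_subgroups d. F \<inter> K = {}}"
proof -
  have "openin (chabauty_topology (Euclidean_space d)) {F. closedin (Euclidean_space d) F \<and> F \<inter> K = {}}"
    unfolding chabauty_topology_def using assms by (intro topology_generated_by_Basis) auto
  moreover have "{F \<in> closed_subgroups d. F \<inter> K = {}} =
      {F. closedin (Euclidean_space d) F \<and> F \<inter> K = {}} \<inter> closed_subgroups d"
    by (auto simp: closed_subgroups_def)
  ultimately show ?thesis unfolding Sub_space_def openin_subtopology by blast
qed

lemma closed_subgroups_fin_vecs: "F \<in> closed_subgroups d \<Longrightarrow> y \<in> F \<Longrightarrow> y \<in> fin_vecs {..<d}"
  by (auto simp: closed_subgroups_iff)

text \<open>Distance below \<open>a\<close> means hitting an open ball. Distance above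
  \<open>a\<close> means missing a closed ball of some radius \<open>b > a\<close>, and such balls
  are compact in \<open>R^d\<close>.\<close>

lemma continuous_map_dist1: "continuous_map (Sub_space d) euclideanreal (dist1 d q)"
  unfolding continuous_map_upper_lower_semicontinuous_lt topspace_Sub_space
proof (intro conjI allI)
  fix a
  let ?b = "{y \<in> fin_vecs {..<d}. norm1 {..<d} (\<lambda>i. q i - y i) < a}"
  have "dist1 d q F < a \<longleftrightarrow> F \<inter> ?b \<noteq> {}" if "F \<in> closed_subgroups d" for F
    using that closed_subgroups_fin_vecs[OF that] by (auto simp: dist1_less closed_subgroups_nonempty)
  then have "{F \<in> closed_subgroups d. dist1 d q F < a} = {F \<in> closed_subgroups d. F \<inter> ?b \<noteq> {}}" by blast
  then show "openin (Sub_space d) {F \<in> closed_subgroups d. dist1 d q F < a}"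
    using openin_Sub_space_hit[OF openin_norm1_ball] by simp
next
  fix a
  let ?c = "\<lambda>b. {y \<in> fin_vecs {..<d}. norm1 {..<d} (\<lambda>i. q i - y i) \<le> b}"
  have "{F \<in> closed_subgroups d. a < dist1 d q F} = (\<Union>b\<in>{a<..}. {F \<in> closed_subgroups d. F \<inter> ?c b = {}})"
  proof (intro equalityI subsetI)
    fix F assume F: "F \<in> {F \<in> closed_subgroups d. a < dist1 d q F}"
    then obtain b where b: "a < b" "b < dist1 d q F" using dense by auto
    have "F \<inter> ?c b = {}" using b(2) dist1_le[of _ F d q] by fastforce
    then show "F \<in> (\<Union>b\<in>{a<..}. {F \<in> closed_subgroups d. F \<inter> ?c b = {}})" using F b by blast
  next
    fix F assume "F \<in> (\<Union>b\<in>{a<..}. {F \<in> closed_subgroups d. F \<inter> ?c b = {}})"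
    then obtain b where b: "a < b" "F \<in> closed_subgroups d" "F \<inter> ?c b = {}" by blast
    then have "b \<le> dist1 d q F"
      using closed_subgroups_fin_vecs[OF b(2)] by (intro dist1_ge closed_subgroups_nonempty) fastforce+
    then show "F \<in> {F \<in> closed_subgroups d. a < dist1 d q F}" using b by auto
  qed
  then show "openin (Sub_space d) {F \<in> closed_subgroups d. a < dist1 d q F}"
    using openin_Sub_space_miss[OF compactin_norm1_cball] by auto
qed

text \<open>The weight makes the map from lattice bases to \<open>closed_subgroups d\<close> uniformly Lipschitz, see
  \<open>dist1_lattice_le\<close>.\<close>
definition dist_funs :: "nat \<Rightarrow> ((nat \<Rightarrow> real) set \<Rightarrow> real) set" where
  "dist_funs d = range (\<lambda>q F. dist1 d q F / (1 + norm1 {..<d} q))"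

text \<open>The neighbourhoods of \<open>F\<close> in the initial topology of
  \<open>dist_funs d\<close> on the closed subgroups, in the form asked for by the second hypothesis
  of \<open>hnull_imp_ind_le\<close>.\<close>

definition dist_nbhd :: "nat \<Rightarrow> (nat \<Rightarrow> real) set \<Rightarrow> (nat \<Rightarrow> real) set set \<Rightarrow> bool" where
  "dist_nbhd d F U \<longleftrightarrow> (\<exists>Q e. finite Q \<and> Q \<subseteq> dist_funs d \<and> 0 < e \<and>
     {G \<in> closed_subgroups d. \<forall>\<phi>\<in>Q. \<bar>\<phi> G - \<phi> F\<bar> < e} \<subseteq> U)"

lemma dist_nbhd_mono: "dist_nbhd d F U \<Longrightarrow> U \<subseteq> V \<Longrightarrow> dist_nbhd d F V"
  unfolding dist_nbhd_def by (meson order_trans)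

lemma dist_nbhd_UNIV: "dist_nbhd d F UNIV"
  unfolding dist_nbhd_def by (intro exI[of _ "{}"] exI[of _ 1]) auto

lemma dist_nbhd_Int:
  assumes "dist_nbhd d F U" "dist_nbhd d F V"
  shows "dist_nbhd d F (U \<inter> V)"
proof -
  obtain Q e where Q: "finite Q" "Q \<subseteq> dist_funs d" "0 < e" "{G \<in> closed_subgroups d. \<forall>\<phi>\<in>Q. \<bar>\<phi> G - \<phi> F\<bar> < e} \<subseteq> U"
    using assms(1) by (auto simp: dist_nbhd_def)
  obtain Q' e' where Q': "finite Q'" "Q' \<subseteq> dist_funs d" "0 < e'" "{G \<in> closed_subgroups d. \<forall>\<phi>\<in>Q'. \<bar>\<phi> G - \<phi> F\<bar> < e'} \<subseteq> V"
    using assms(2) by (auto simp: dist_nbhd_def)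
  have "{G \<in> closed_subgroups d. \<forall>\<phi>\<in>Q \<union> Q'. \<bar>\<phi> G - \<phi> F\<bar> < min e e'} \<subseteq> U \<inter> V"
    using Q(4) Q'(4) by auto
  then show ?thesis unfolding dist_nbhd_def using Q Q' by (intro exI[of _ "Q \<union> Q'"] exI[of _ "min e e'"]) auto
qed

lemma dist_nbhd_INT: "finite T \<Longrightarrow> (\<And>x. x \<in> T \<Longrightarrow> dist_nbhd d F (U x)) \<Longrightarrow> dist_nbhd d F (\<Inter>x\<in>T. U x)"
  by (induction T rule: finite_induct) (auto simp: dist_nbhd_UNIV dist_nbhd_Int)

lemma dist_nbhd_dist1:
  assumes "0 < e" shows "dist_nbhd d F {G \<in> closed_subgroups d. \<bar>dist1 d q G - dist1 d q F\<bar> < e}"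
  unfolding dist_nbhd_def
proof (intro exI conjI)
  let ?n = "1 + norm1 {..<d} q"
  let ?\<phi> = "\<lambda>F. dist1 d q F / ?n"
  have n: "0 < ?n" by (simp add: add_pos_nonneg)
  show "finite {?\<phi>}" "{?\<phi>} \<subseteq> dist_funs d" by (auto simp: dist_funs_def)
  show "0 < e / ?n" using assms n by simp
  have "\<bar>dist1 d q G - dist1 d q F\<bar> < e" if "\<bar>?\<phi> G - ?\<phi> F\<bar> < e / ?n" for G
    using that n unfolding diff_divide_distrib[symmetric] abs_divide by (simp add: divide_less_cancel)
  then show "{G \<in> closed_subgroups d. \<forall>\<phi>\<in>{?\<phi>}. \<bar>\<phi> G - \<phi> F\<bar> < e / ?n} \<subseteq> {G \<in> closed_subgroups d. \<bar>dist1 d q G - dist1 d q F\<bar> < e}"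
    by auto
qed

lemma dist_nbhd_closed_subgroups: "dist_nbhd d F (closed_subgroups d)"
  by (rule dist_nbhd_mono[OF dist_nbhd_dist1[of 1 d F "\<lambda>_. 0"]]) auto

text \<open>Only subbasic sets carry content. A missed compact set is covered by finitely many
  balls, and the distances to their centres control missing it; a hit open set contains a ball about
  a point of \<open>F\<close>, whose distance from \<open>F\<close> is 0.\<close>

lemma dist_nbhd_chabauty:
  assumes "generate_topology_on
     ({{F. closedin (Euclidean_space d) F \<and> F \<inter> K = {}} | K. compactin (Euclidean_space d) K} \<union>
      {{F. closedin (Euclidean_space d) F \<and> F \<inter> U \<noteq> {}} | U. openin (Euclidean_space d) U}) W"
    and F: "F \<in> closed_subgroups d"
  shows "F \<in> W \<Longrightarrow> dist_nbhd d F W"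
  using assms(1)
proof induction
  case (Int a b)
  then show ?case by (intro dist_nbhd_Int) auto
next
  case (UN K)
  then show ?case by (meson UnionE Union_upper dist_nbhd_mono)
next
  case (Basis s)
  let ?V = "fin_vecs {..<d}"
  let ?b = "\<lambda>x e. {y \<in> ?V. norm1 {..<d} (\<lambda>i. x i - y i) < e}"
  have cl: "closedin (Euclidean_space d) G" if "G \<in> closed_subgroups d" for G using that by (simp add: closed_subgroups_def)
  from Basis consider K where "compactin (Euclidean_space d) K" "s = {F. closedin (Euclidean_space d) F \<and> F \<inter> K = {}}"
    | U where "openin (Euclidean_space d) U" "s = {F. closedin (Euclidean_space d) F \<and> F \<inter> U \<noteq> {}}" by blast
  then show ?case
  proof cases
    case 1
    have KV: "K \<subseteq> ?V" using compactin_subset_topspace[OF 1(1)] topspace_Euclidean_space_fin_vecs by simp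
    have FK: "F \<inter> K = {}" using Basis 1 by auto
    \<comment> \<open>Half the distance: if the distance from \<open>x\<close> changes by less than
      \<open>a x\<close>, it stays above \<open>a x\<close>, the radius of the ball.\<close>
    define a where "a = (\<lambda>x. dist1 d x F / 2)"
    have a: "0 < a x" if "x \<in> K" for x using dist1_pos[OF F, of x] that FK KV by (auto simp: a_def)
    have cov: "K \<subseteq> \<Union>((\<lambda>x. ?b x (a x)) ` K)"
    proof
      fix x assume "x \<in> K"
      then have "x \<in> ?b x (a x)" using a[of x] KV by (auto simp: norm1_def)
      then show "x \<in> \<Union>((\<lambda>x. ?b x (a x)) ` K)" using \<open>x \<in> K\<close> by (rule UN_I[rotated])
    qed
    have op: "openin (Euclidean_space d) U" if "U \<in> (\<lambda>x. ?b x (a x)) ` K" for U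
      using that openin_norm1_ball by auto
    have "\<exists>\<F>. finite \<F> \<and> \<F> \<subseteq> (\<lambda>x. ?b x (a x)) ` K \<and> K \<subseteq> \<Union>\<F>"
      by (rule compactinD[OF 1(1) op cov])
    then obtain \<F> where \<F>: "finite \<F>" "\<F> \<subseteq> (\<lambda>x. ?b x (a x)) ` K" "K \<subseteq> \<Union>\<F>"
      by (elim exE conjE)
    then obtain T where T: "finite T" "T \<subseteq> K" "\<F> = (\<lambda>x. ?b x (a x)) ` T" by (meson finite_subset_image)
    have "dist_nbhd d F {G \<in> closed_subgroups d. G \<inter> ?b x (a x) = {}}" if "x \<in> K" for x
    proof (rule dist_nbhd_mono[OF dist_nbhd_dist1[OF a[OF that]]], clarify)
      fix G assume G: "G \<in> closed_subgroups d" "\<bar>dist1 d x G - dist1 d x F\<bar> < a x"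
      then have "a x < dist1 d x G" unfolding a_def abs_less_iff by linarith
      then show "G \<inter> ?b x (a x) = {}" using dist1_le[of _ G d x] by fastforce
    qed
    then have "dist_nbhd d F (closed_subgroups d \<inter> (\<Inter>x\<in>T. {G \<in> closed_subgroups d. G \<inter> ?b x (a x) = {}}))"
      using T by (intro dist_nbhd_Int dist_nbhd_INT dist_nbhd_closed_subgroups) auto
    then show ?thesis
    proof (rule dist_nbhd_mono, intro subsetI)
      fix G assume G: "G \<in> closed_subgroups d \<inter> (\<Inter>x\<in>T. {G \<in> closed_subgroups d. G \<inter> ?b x (a x) = {}})"
      then have Gc: "G \<in> closed_subgroups d" by blast
      have "\<And>x. x \<in> T \<Longrightarrow> G \<inter> ?b x (a x) = {}" using G by blast
      then have "G \<inter> \<Union>\<F> = {}" unfolding T(3) by (simp add: Int_UN_distrib)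
      then have "G \<inter> K = {}" using \<F>(3) by blast
      then show "G \<in> s" using cl[OF Gc] unfolding 1(2) by simp
    qed
  next
    case 2
    then obtain x where x: "x \<in> F" "x \<in> U" using Basis by auto
    obtain e where e: "e > 0" "\<forall>y\<in>?V. norm1 {..<d} (\<lambda>i. x i - y i) < e \<longrightarrow> y \<in> U"
      using openin_Euclidean_space_norm1[OF 2(1) x(2)] by blast
    show ?thesis
    proof (rule dist_nbhd_mono[OF dist_nbhd_dist1[OF e(1), of d F x]], clarify)
      fix G assume G: "G \<in> closed_subgroups d" "\<bar>dist1 d x G - dist1 d x F\<bar> < e"
      then have "dist1 d x G < e" using dist1_self[OF x(1)] by simp
      then obtain y where "y \<in> G" "norm1 {..<d} (\<lambda>i. x i - y i) < e" using dist1_less closed_subgroups_nonempty[OF G(1)] by blast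
      moreover from this have "y \<in> U" using e(2) closed_subgroups_fin_vecs[OF G(1)] by simp
      ultimately show "G \<in> s" using cl[OF G(1)] unfolding 2(2) by auto
    qed
  qed
qed simp

lemma dist_nbhd_Sub_space:
  assumes "openin (Sub_space d) W" "F \<in> W"
  shows "dist_nbhd d F W"
proof -
  obtain T where T: "openin (chabauty_topology (Euclidean_space d)) T" "W = T \<inter> closed_subgroups d"
    using assms(1) unfolding Sub_space_def openin_subtopology by blast
  have "dist_nbhd d F T"
    using T assms(2) by (intro dist_nbhd_chabauty) (auto simp: chabauty_topology_def openin_topology_generated_by_iff)
  then show ?thesis unfolding T(2) by (rule dist_nbhd_Int[OF _ dist_nbhd_closed_subgroups])
qed

lemma continuous_map_dist_funs: "\<phi> \<in> dist_funs d \<Longrightarrow> continuous_map (Sub_space d) euclideanreal \<phi>"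
  unfolding dist_funs_def using continuous_map_dist1
  by (auto simp: divide_inverse intro!: continuous_map_real_mult)

section \<open>Lipschitz dependence on the generators\<close>

text \<open>A parameter \<open>x\<close> is a \<open>d\<close> by \<open>d\<close> matrix; the entry \<open>i\<close> of column \<open>j\<close> has index \<open>j * d + i\<close>.\<close>
definition basis_of :: "nat \<Rightarrow> (nat \<Rightarrow> real) \<Rightarrow> nat \<Rightarrow> nat \<Rightarrow> real" where
  "basis_of d x j i = (if i < d then x (j * d + i) else 0)"

text \<open>Non-discrete groups are included: \<open>G j = UNIV\<close> makes column
  \<open>j\<close> span a line, and \<open>G j = {0}\<close> discards it.\<close>

definition lattice_of :: "nat \<Rightarrow> (nat \<Rightarrow> real set) \<Rightarrow> (nat \<Rightarrow> real) \<Rightarrow> (nat \<Rightarrow> real) set" where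
  "lattice_of d G x = lin_comb {..<d} (basis_of d x) ` {h. \<forall>j\<in>{..<d}. h j \<in> G j}"

lemma index_less_square: "j < d \<Longrightarrow> i < d \<Longrightarrow> j * d + i < d\<^sup>2" for d :: nat
proof -
  assume "j < d" "i < d"
  then have "j * d + i < Suc j * d" "Suc j * d \<le> d * d" by (simp, intro mult_right_mono) auto
  then show ?thesis by (simp add: power2_eq_square)
qed

lemma lin_comb_basis_perturb:
  assumes "\<And>k. k < d\<^sup>2 \<Longrightarrow> \<bar>x k - x' k\<bar> \<le> \<eta>"
  shows "norm1 {..<d} (\<lambda>i. lin_comb {..<d} (basis_of d x) h i - lin_comb {..<d} (basis_of d x') h i) \<le> real d * \<eta> * norm1 {..<d} h"
proof -
  have "\<bar>lin_comb {..<d} (basis_of d x) h i - lin_comb {..<d} (basis_of d x') h i\<bar> \<le> \<eta> * norm1 {..<d} h" if "i < d" for i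
  proof -
    have "lin_comb {..<d} (basis_of d x) h i - lin_comb {..<d} (basis_of d x') h i = (\<Sum>j<d. h j * (x (j * d + i) - x' (j * d + i)))"
      using that by (simp add: lin_comb_def basis_of_def sum_subtractf right_diff_distrib)
    also have "\<bar>\<dots>\<bar> \<le> (\<Sum>j<d. \<eta> * \<bar>h j\<bar>)"
    proof (intro order_trans[OF sum_abs] sum_mono)
      fix j assume "j \<in> {..<d}"
      then have "\<bar>x (j * d + i) - x' (j * d + i)\<bar> \<le> \<eta>" using assms index_less_square that by simp
      then show "\<bar>h j * (x (j * d + i) - x' (j * d + i))\<bar> \<le> \<eta> * \<bar>h j\<bar>"
        unfolding abs_mult mult.commute[of "\<bar>h j\<bar>"] by (intro mult_right_mono) auto
    qed
    finally show ?thesis by (simp add: norm1_def sum_distrib_left)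
  qed
  then have "norm1 {..<d} (\<lambda>i. lin_comb {..<d} (basis_of d x) h i - lin_comb {..<d} (basis_of d x') h i) \<le> (\<Sum>i<d. \<eta> * norm1 {..<d} h)"
    unfolding norm1_def[of _ "\<lambda>i. _ i - _ i"] by (intro sum_mono) auto
  then show ?thesis by simp
qed

text \<open>Only lattice points of norm at most \<open>2 * norm1 q\<close> compete for the distance to \<open>q\<close>, and by
  the coefficient bound such points have bounded coefficients.\<close>
lemma dist1_lattice_le:
  assumes G: "\<And>j. j < d \<Longrightarrow> 0 \<in> G j" and "0 \<le> c" and eta: "0 \<le> \<eta>"
    and c: "\<And>h. \<forall>j\<in>{..<d}. h j \<in> G j \<Longrightarrow> norm1 {..<d} h \<le> c * norm1 {..<d} (lin_comb {..<d} (basis_of d x) h)"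
    and x: "\<And>k. k < d\<^sup>2 \<Longrightarrow> \<bar>x k - x' k\<bar> \<le> \<eta>"
  shows "dist1 d q (lattice_of d G x') \<le> dist1 d q (lattice_of d G x) + 2 * real d * c * \<eta> * norm1 {..<d} q"
proof -
  let ?n = "norm1 {..<d}"
  define D where "D = 2 * real d * c * \<eta> * ?n q"
  have D0: "0 \<le> D" using \<open>0 \<le> c\<close> eta by (simp add: D_def)
  have zero: "(\<lambda>i. 0) \<in> lattice_of d G x'" using G
    unfolding lattice_of_def by (intro image_eqI[of _ _ "\<lambda>_. 0"]) (auto simp: lin_comb_def)
  have ne: "lattice_of d G x \<noteq> {}" using G by (auto simp: lattice_of_def intro!: exI[of _ "\<lambda>_. 0"])
  have "dist1 d q (lattice_of d G x') - D \<le> dist1 d q (lattice_of d G x)"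
  proof (rule dist1_ge[OF ne])
    fix y assume "y \<in> lattice_of d G x"
    then obtain h where h: "\<forall>j\<in>{..<d}. h j \<in> G j" "y = lin_comb {..<d} (basis_of d x) h" by (auto simp: lattice_of_def)
    show "dist1 d q (lattice_of d G x') - D \<le> ?n (\<lambda>i. q i - y i)"
    \<comment> \<open>In the first case 0, which lies in both groups, is at least as close to
      \<open>q\<close> as \<open>y\<close>.\<close>
    proof (cases "?n q \<le> ?n (\<lambda>i. q i - y i)")
      case True
      have "dist1 d q (lattice_of d G x') \<le> ?n q" using dist1_le[OF zero, of d q] by simp
      then show ?thesis using True D0 by simp
    next
      case False
      have "?n y = ?n (\<lambda>i. q i - (q i - y i))" by simp
      also have "\<dots> \<le> ?n q + ?n (\<lambda>i. q i - y i)" by (rule norm1_diff)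
      finally have "?n y \<le> 2 * ?n q" using False by simp
      then have "c * ?n y \<le> c * (2 * ?n q)" using \<open>0 \<le> c\<close> by (rule mult_left_mono)
      then have nh: "?n h \<le> c * (2 * ?n q)" using c[OF h(1)]  h(2) by simp
      define y' where "y' = lin_comb {..<d} (basis_of d x') h"
      have "?n (\<lambda>i. y i - y' i) \<le> real d * \<eta> * ?n h"
        unfolding  h(2) y'_def using x by (rule lin_comb_basis_perturb)
      also have "\<dots> \<le> real d * \<eta> * (c * (2 * ?n q))" using nh eta by (intro mult_left_mono) auto
      finally have yy: "?n (\<lambda>i. y i - y' i) \<le> D" by (simp add: D_def mult_ac)
      have "y' \<in> lattice_of d G x'" unfolding y'_def lattice_of_def using h(1) by blast
      then have "dist1 d q (lattice_of d G x') \<le> ?n (\<lambda>i. q i - y' i)" by (rule dist1_le)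
      also have "\<dots> = ?n (\<lambda>i. (q i - y i) + (y i - y' i))" by simp
      also have "\<dots> \<le> ?n (\<lambda>i. q i - y i) + ?n (\<lambda>i. y i - y' i)" by (rule norm1_add)
      finally show ?thesis using yy by simp
    qed
  qed
  then show ?thesis by (simp add: D_def)
qed

text \<open>The Lipschitz constant of the distances depends on a matrix through \<open>c\<close>
  only, so it is uniform on this set.\<close>

definition good_params :: "nat \<Rightarrow> (nat \<Rightarrow> real set) \<Rightarrow> real \<Rightarrow> (nat \<Rightarrow> real) set" where
  "good_params d G c = {x. \<forall>h. (\<forall>j\<in>{..<d}. h j \<in> G j) \<longrightarrow>
     norm1 {..<d} h \<le> c * norm1 {..<d} (lin_comb {..<d} (basis_of d x) h)}"

lemma dist1_lattice_Lipschitz: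
  assumes G: "\<And>j. j < d \<Longrightarrow> 0 \<in> G j" and "0 \<le> c" "0 \<le> \<eta>"
    and "x \<in> good_params d G c" "x' \<in> good_params d G c"
    and x: "\<And>k. k < d\<^sup>2 \<Longrightarrow> \<bar>x k - x' k\<bar> \<le> \<eta>"
  shows "\<bar>dist1 d q (lattice_of d G x) - dist1 d q (lattice_of d G x')\<bar> \<le> 2 * real d * c * \<eta> * norm1 {..<d} q"
proof -
  have x': "\<bar>x' k - x k\<bar> \<le> \<eta>" if "k < d\<^sup>2" for k using x[OF that] by (simp add: abs_minus_commute)
  have "dist1 d q (lattice_of d G x') \<le> dist1 d q (lattice_of d G x) + 2 * real d * c * \<eta> * norm1 {..<d} q"
    by (rule dist1_lattice_le) (use assms in \<open>auto simp: good_params_def\<close>)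
  moreover have "dist1 d q (lattice_of d G x) \<le> dist1 d q (lattice_of d G x') + 2 * real d * c * \<eta> * norm1 {..<d} q"
    by (rule dist1_lattice_le) (use assms x' in \<open>auto simp: good_params_def\<close>)
  ultimately show ?thesis by (simp add: abs_le_iff)
qed

lemma osc_le_lattice:
  assumes G: "\<And>j. j < d \<Longrightarrow> 0 \<in> G j" and c: "0 \<le> c" and eta: "0 \<le> \<eta>" and A: "A \<subseteq> good_params d G c"
    and x: "\<And>x x' k. x \<in> A \<Longrightarrow> x' \<in> A \<Longrightarrow> k < d\<^sup>2 \<Longrightarrow> \<bar>x k - x' k\<bar> \<le> \<eta>"
  shows "osc_le (dist_funs d) (lattice_of d G ` A) (2 * real d * c * \<eta>)"
  unfolding osc_le_def
proof (intro conjI ballI)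
  show "0 \<le> 2 * real d * c * \<eta>" using c eta by simp
  fix F F' \<phi> assume F: "F \<in> lattice_of d G ` A" "F' \<in> lattice_of d G ` A" and "\<phi> \<in> dist_funs d"
  then obtain q where q: "\<phi> = (\<lambda>F. dist1 d q F / (1 + norm1 {..<d} q))" by (auto simp: dist_funs_def)
  obtain x x' where x': "x \<in> A" "x' \<in> A" "F = lattice_of d G x" "F' = lattice_of d G x'" using F by auto
  let ?n = "norm1 {..<d} q"
  have n: "0 < 1 + ?n" by (simp add: add_pos_nonneg)
  have "\<bar>dist1 d q F - dist1 d q F'\<bar> \<le> 2 * real d * c * \<eta> * ?n"
    unfolding x'(3,4) using x'(1,2) A by (intro dist1_lattice_Lipschitz G c eta x) auto
  also have "\<dots> \<le> 2 * real d * c * \<eta> * (1 + ?n)" using c eta by (intro mult_left_mono) auto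
  finally show "\<bar>\<phi> F - \<phi> F'\<bar> \<le> 2 * real d * c * \<eta>"
    unfolding q diff_divide_distrib[symmetric] abs_divide using n by (simp add: pos_divide_le_eq)
qed

text \<open>A grid of mesh \<open>1 / K\<close> has \<open>(2 * R * K + 1) ^ N\<close> cells, and
  the group varies over a cell by a multiple of \<open>1 / K\<close>. At exponent
  \<open>N + 1\<close> the total cost is at most \<open>C / K\<close>.\<close>

lemma hnull_lattices:
  assumes G: "\<And>j. j < d \<Longrightarrow> 0 \<in> G j" and c: "0 \<le> c"
  shows "hnull (dist_funs d) (Suc (d\<^sup>2)) (lattice_of d G ` {x \<in> good_params d G c. \<forall>k<d\<^sup>2. \<bar>x k\<bar> \<le> real R})"
proof (rule hnull_finite_covers)
  fix e :: real assume "0 < e"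
  define N where "N = d\<^sup>2"
  define C where "C = (2 * real R + 1) ^ N * (2 * real d * c) ^ Suc N"
  have C0: "0 \<le> C" using c by (simp add: C_def)
  obtain K :: nat where K: "C / e < real K" using reals_Archimedean2 by blast
  have K0: "0 < real K" using C0 \<open>0 < e\<close> by (intro le_less_trans[OF _ K]) simp
  define M where "M = {..<N} \<rightarrow>\<^sub>E {- int (R * K)..int (R * K)}"
  have finM: "finite M" unfolding M_def by (intro finite_PiE) auto
  have cardM: "card M = (2 * R * K + 1) ^ N"
  proof -
    have "card {- int (R * K)..int (R * K)} = 2 * R * K + 1" by (simp add: nat_eq_iff)
    then show ?thesis unfolding M_def by (simp add: card_PiE del: card_atLeastAtMost_int)
  qed
  define cell where "cell = (\<lambda>m::nat \<Rightarrow> int. {x \<in> good_params d G c. \<forall>k<N. real_of_int (m k) / real K \<le> x k \<and> x k \<le> (real_of_int (m k) + 1) / real K})"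
  define \<B> where "\<B> = (\<lambda>m. lattice_of d G ` cell m) ` M"
  define r where "r = 2 * real d * c * (1 / real K)"
  have "osc_le (dist_funs d) B r" if B: "B \<in> \<B>" for B
  proof -
    obtain m where m: "B = lattice_of d G ` cell m" using B by (auto simp: \<B>_def)
    show ?thesis unfolding m r_def
    proof (rule osc_le_lattice[OF G c])
      fix x x' k assume xx: "x \<in> cell m" "x' \<in> cell m" "k < d\<^sup>2"
      have "(real_of_int (m k) + 1) / real K = real_of_int (m k) / real K + 1 / real K" by (simp add: add_divide_distrib)
      moreover have "real_of_int (m k) / real K \<le> x k" "x k \<le> (real_of_int (m k) + 1) / real K"
        "real_of_int (m k) / real K \<le> x' k" "x' k \<le> (real_of_int (m k) + 1) / real K"
        using xx by (auto simp: cell_def N_def)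
      ultimately show "\<bar>x k - x' k\<bar> \<le> 1 / real K" by linarith
    qed (auto simp: cell_def)
  qed
  moreover have "lattice_of d G ` {x \<in> good_params d G c. \<forall>k<d\<^sup>2. \<bar>x k\<bar> \<le> real R} \<subseteq> \<Union>\<B>"
  proof
    fix F assume "F \<in> lattice_of d G ` {x \<in> good_params d G c. \<forall>k<d\<^sup>2. \<bar>x k\<bar> \<le> real R}"
    then obtain x where x: "F = lattice_of d G x" "x \<in> good_params d G c" "\<And>k. k < N \<Longrightarrow> \<bar>x k\<bar> \<le> real R" by (auto simp: N_def)
    define m where "m = (\<lambda>k\<in>{..<N}. \<lfloor>x k * real K\<rfloor>)"
    have "m \<in> M"
      unfolding M_def
    proof (rule PiE_I)
      fix k assume k: "k \<in> {..<N}"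
      have "\<bar>x k * real K\<bar> \<le> real R * real K" unfolding abs_mult using x(3)[of k] k K0 by (intro mult_mono) auto
      then have "x k * real K \<le> real_of_int (int (R * K))" "real_of_int (- int (R * K)) \<le> x k * real K" by (auto simp: abs_le_iff)
      then have "\<lfloor>x k * real K\<rfloor> \<le> int (R * K)" "- int (R * K) \<le> \<lfloor>x k * real K\<rfloor>"
        using floor_mono[of "x k * real K" "real_of_int (int (R * K))"] by (simp_all only: floor_of_int le_floor_iff)
      then show "m k \<in> {- int (R * K)..int (R * K)}" using k by (simp add: m_def)
    qed (simp add: m_def)
    moreover have "x \<in> cell m"
      unfolding cell_def using x(2) K0
      by (auto simp: m_def pos_divide_le_eq pos_le_divide_eq intro: less_imp_le)
    ultimately have "lattice_of d G ` cell m \<in> \<B>" "F \<in> lattice_of d G ` cell m"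
      unfolding \<B>_def x(1) by simp_all
    then show "F \<in> \<Union>\<B>" by (rule UnionI)
  qed
  moreover have "real (card \<B>) * r ^ Suc (d\<^sup>2) < e"
  proof -
    have r0: "0 \<le> r" using c by (simp add: r_def)
    have "card \<B> \<le> (2 * R * K + 1) ^ N" unfolding \<B>_def cardM[symmetric] by (rule card_image_le[OF finM])
    then have "real (card \<B>) \<le> real ((2 * R * K + 1) ^ N)" by (simp only: of_nat_le_iff)
    also have "\<dots> = (1 + 2 * real R * real K) ^ N" by simp
    also have "\<dots> \<le> ((2 * real R + 1) * real K) ^ N"
      using K0 by (intro power_mono) (auto simp: algebra_simps)
    finally have "real (card \<B>) * r ^ Suc N \<le> ((2 * real R + 1) * real K) ^ N * r ^ Suc N"
      using r0 by (intro mult_right_mono) auto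
    also have "\<dots> = C / real K" using K0 by (simp add: C_def r_def power_mult_distrib power_divide)
    also have "\<dots> < e" using K K0 \<open>0 < e\<close> by (simp add: field_simps)
    finally show ?thesis by (simp add: N_def)
  qed
  ultimately show "\<exists>\<B> r. finite \<B> \<and> lattice_of d G ` {x \<in> good_params d G c. \<forall>k<d\<^sup>2. \<bar>x k\<bar> \<le> real R} \<subseteq> \<Union>\<B> \<and>
      (\<forall>B\<in>\<B>. osc_le (dist_funs d) B r) \<and> 0 \<le> r \<and> real (card \<B>) * r ^ Suc (d\<^sup>2) < e"
    using finM c by (intro exI[of _ \<B>] exI[of _ r]) (simp add: \<B>_def r_def)
qed

lemma closed_subgroup_is_lattice:
  assumes "H \<in> closed_subgroups d"
  shows "\<exists>G\<in>{..<d} \<rightarrow>\<^sub>E {UNIV, \<int>, {0}}. \<exists>c R. H \<in> lattice_of d G ` {x \<in> good_params d G (real c). \<forall>k<d\<^sup>2. \<bar>x k\<bar> \<le> real R}"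
proof -
  have H: "add_subgroup H" "closed H" "H \<subseteq> fin_vecs {..<d}" using assms closed_subgroups_iff by auto
  have "\<exists>w G c. (\<forall>j. G j \<in> {UNIV, \<int>, {0}}) \<and> coef_system {..<d} w G c H"
    by (rule closed_subgroup_coef_system[OF _ H]) simp
  then obtain w G c where w: "\<forall>j. G j \<in> {UNIV, \<int>, {0}}" "coef_system {..<d} w G c H" by (elim exE conjE)
  \<comment> \<open>The restriction makes the coefficient types range over a finite set of
    functions; \<open>c\<close> and the size of the matrix are rounded up to naturals below, so that
    all pieces together are countably many.\<close>
  define G' where "G' = restrict G {..<d}"
  define x where "x = (\<lambda>k. w (k div d) (k mod d))"
  have G': "(\<forall>j\<in>{..<d}. h j \<in> G' j) \<longleftrightarrow> (\<forall>j\<in>{..<d}. h j \<in> G j)" for h by (simp add: G'_def)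
  have lc: "lin_comb {..<d} (basis_of d x) h = lin_comb {..<d} w h" if "\<forall>j\<in>{..<d}. h j \<in> G j" for h
  proof
    fix i
    \<comment> \<open>\<open>basis_of\<close> cuts the generators off at coordinate
      \<open>d\<close>. A single \<open>w j\<close> may have entries beyond, but admissible
      combinations lie in \<open>H\<close> and so have none.\<close>
    have "lin_comb {..<d} w h \<in> H" using w(2) that unfolding coef_system_def by blast
    then have "lin_comb {..<d} w h i = 0" if "\<not> i < d" using H(3) that by (auto simp: fin_vecs_def)
    moreover have "lin_comb {..<d} (basis_of d x) h i = lin_comb {..<d} w h i" if "i < d"
      using that by (simp add: lin_comb_def basis_of_def x_def)
    ultimately show "lin_comb {..<d} (basis_of d x) h i = lin_comb {..<d} w h i"
      by (cases "i < d") (auto simp: lin_comb_def basis_of_def)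
  qed
  obtain c' :: nat where c': "c \<le> real c'" using real_arch_simple by blast
  have "x \<in> good_params d G' (real c')"
    unfolding good_params_def G'
  proof (intro CollectI allI impI)
    fix h assume h: "\<forall>j\<in>{..<d}. h j \<in> G j"
    have "norm1 {..<d} h \<le> c * norm1 {..<d} (lin_comb {..<d} w h)" using w(2) h unfolding coef_system_def by blast
    also have "\<dots> \<le> real c' * norm1 {..<d} (lin_comb {..<d} w h)" using c' by (intro mult_right_mono) auto
    finally show "norm1 {..<d} h \<le> real c' * norm1 {..<d} (lin_comb {..<d} (basis_of d x) h)" using lc[OF h] by simp
  qed
  moreover have "H = lattice_of d G' x"
    using w(2) lc unfolding coef_system_def lattice_of_def G' by (auto simp: image_iff)
  moreover obtain R :: nat where R: "(\<Sum>k<d\<^sup>2. \<bar>x k\<bar>) \<le> real R" using real_arch_simple by blast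
  have "\<bar>x k\<bar> \<le> real R" if "k < d\<^sup>2" for k
    using member_le_sum[of k "{..<d\<^sup>2}" "\<lambda>k. \<bar>x k\<bar>"] R that by simp
  moreover have "G' \<in> {..<d} \<rightarrow>\<^sub>E {UNIV, \<int>, {0}}" using w(1) by (auto simp: G'_def)
  ultimately show ?thesis by (intro bexI[of _ G'] exI[of _ c'] exI[of _ R] image_eqI[of _ _ x] CollectI conjI allI impI)
qed

lemma hnull_closed_subgroups: "hnull (dist_funs d) (Suc (d\<^sup>2)) (closed_subgroups d)"
proof (rule hnull_subset)
  let ?GG = "{..<d} \<rightarrow>\<^sub>E {UNIV, \<int>, {0::real}}"
  let ?L = "\<lambda>(G, c, R). lattice_of d G ` {x \<in> good_params d G (real c). \<forall>k<d\<^sup>2. \<bar>x k\<bar> \<le> real R}"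
  let ?I = "?GG \<times> (UNIV :: nat set) \<times> (UNIV :: nat set)"
  have "countable ?GG" by (intro countable_finite finite_PiE) auto
  then have "countable ?I" by (intro countable_SIGMA) auto
  then show "hnull (dist_funs d) (Suc (d\<^sup>2)) (\<Union>(?L ` ?I))"
  proof (intro hnull_countable_Union)
    fix A assume "A \<in> ?L ` ?I"
    then obtain G c R where A: "G \<in> ?GG" "A = ?L (G, c, R)" by (elim imageE SigmaE) simp
    have "0 \<in> G j" if "j < d" for j
    proof -
      have "G j \<in> {UNIV, \<int>, {0}}" by (rule PiE_mem[OF A(1)]) (simp add: that)
      then show ?thesis by (elim insertE) simp_all
    qed
    then show "hnull (dist_funs d) (Suc (d\<^sup>2)) A" unfolding A(2) by (simp add: hnull_lattices)
  qed simp
  show "closed_subgroups d \<subseteq> \<Union>(?L ` ?I)"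
  proof
    fix H assume "H \<in> closed_subgroups d"
    from closed_subgroup_is_lattice[OF this] obtain G c R where G: "G \<in> ?GG" "H \<in> ?L (G, c, R)"
      unfolding prod.case by (elim bexE exE)
    show "H \<in> \<Union>(?L ` ?I)" by (rule UN_I[of "(G, c, R)"]) (use G in simp_all)
  qed
qed

theorem ind_le_Sub_space: "ind_le (Suc (d\<^sup>2)) (Sub_space d)"
proof -
  have "ind_le (Suc (d\<^sup>2)) (subtopology (Sub_space d) (topspace (Sub_space d)))"
  proof (rule hnull_imp_ind_le[of "dist_funs d"])
    show "\<exists>Q e. finite Q \<and> Q \<subseteq> dist_funs d \<and> 0 < e \<and> {y \<in> topspace (Sub_space d). \<forall>\<phi>\<in>Q. \<bar>\<phi> y - \<phi> x\<bar> < e} \<subseteq> U"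
      if "openin (Sub_space d) U" "x \<in> U" for U x
      using dist_nbhd_Sub_space[OF that] unfolding dist_nbhd_def topspace_Sub_space .
  qed (simp_all add: continuous_map_dist_funs topspace_Sub_space hnull_closed_subgroups)
  then show ?thesis by simp
qed

section \<open>A cube of lattices\<close>

definition cube :: "nat \<Rightarrow> (nat \<Rightarrow> real) set" where
  "cube n = {x. \<forall>i. (i \<in> {..<n} \<longrightarrow> \<bar>x i\<bar> \<le> 1) \<and> (i \<notin> {..<n} \<longrightarrow> x i = 0)}"

text \<open>Without a common zero, normalising \<open>g\<close> retracts the cube to the unit sphere
  inside it. Composed with the scaling of the sphere towards 0, the retraction contracts the
  sphere.\<close>

lemma no_retraction_cube:
  assumes n: "0 < n"
    and g: "\<And>i. i < n \<Longrightarrow> continuous_map (top_of_set (cube n)) euclideanreal (g i)"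
    and id: "\<And>x i. x \<in> cube n \<Longrightarrow> (\<Sum>i<n. (x i)\<^sup>2) = 1 \<Longrightarrow> i < n \<Longrightarrow> g i x = x i"
  shows "\<exists>x\<in>cube n. \<forall>i<n. g i x = 0"
proof (rule ccontr)
  assume "\<not> ?thesis"
  then have nz: "\<exists>i<n. g i x \<noteq> 0" if "x \<in> cube n" for x using that by blast
  obtain m where m: "n = Suc m" using n by (cases n) auto
  let ?S = "nsphere m"
  have tS: "topspace ?S = {x. (\<Sum>i<n. (x i)\<^sup>2) = 1 \<and> (\<forall>i\<ge>n. x i = 0)}"
    by (auto simp: nsphere m lessThan_Suc_atMost Suc_le_eq)
  have bound: "\<bar>x i\<bar> \<le> 1" if "(\<Sum>i<n. (x i)\<^sup>2) = 1" "i < n" for x :: "nat \<Rightarrow> real" and i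
  proof -
    have "(x i)\<^sup>2 \<le> (\<Sum>i<n. (x i)\<^sup>2)" using that(2) by (intro member_le_sum) auto
    then show ?thesis using that(1) by (simp add: abs_square_le_1)
  qed
  have in_cube: "(\<lambda>i. t * x i) \<in> cube n" if "x \<in> topspace ?S" "t \<in> {0..1}" for t x
    using that bound[of x] by (auto simp: tS cube_def abs_mult mult_le_one)
  define r where "r = (\<lambda>x. sqrt (\<Sum>i<n. (g i x)\<^sup>2))"
  have rpos: "0 < r x" if "x \<in> cube n" for x
  proof -
    obtain i where i: "i < n" "g i x \<noteq> 0" using nz \<open>x \<in> cube n\<close> by blast
    have "0 < (g i x)\<^sup>2" using i by simp
    also have "\<dots> \<le> (\<Sum>i<n. (g i x)\<^sup>2)" using i(1) by (intro member_le_sum) auto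
    finally show ?thesis by (simp add: r_def)
  qed
  define s where "s = (\<lambda>x i. if i < n then g i x / r x else 0)"
  have contr: "continuous_map (top_of_set (cube n)) euclideanreal r"
    unfolding r_def using g by (intro continuous_map_sqrt continuous_map_sum continuous_map_real_pow) auto
  have "continuous_map (top_of_set (cube n)) (Euclidean_space n) s"
    unfolding s_def continuous_map_componentwise_Euclidean_space
    using g contr rpos by (intro allI impI continuous_map_real_divide) force+
  moreover have ss: "(\<Sum>i<n. (s x i)\<^sup>2) = 1" if "x \<in> cube n" for x
  proof -
    have "(\<Sum>i<n. (s x i)\<^sup>2) = (\<Sum>i<n. (g i x)\<^sup>2) / (r x)\<^sup>2"
      by (simp add: s_def power_divide sum_divide_distrib)
    also have "(r x)\<^sup>2 = (\<Sum>i<n. (g i x)\<^sup>2)" by (simp add: r_def sum_nonneg)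
    finally show ?thesis using rpos[OF that] by (simp add: r_def)
  qed
  ultimately have conts: "continuous_map (top_of_set (cube n)) ?S s"
    unfolding nsphere_def continuous_map_in_subtopology m[symmetric] by (auto simp: m lessThan_Suc_atMost)
  let ?T = "top_of_set {0..1::real}"
  let ?P = "prod_topology ?T ?S"
  have "continuous_map ?P (top_of_set (cube n)) (\<lambda>(t, x) i. t * x i)"
    unfolding continuous_map_in_subtopology euclidean_product_topology[symmetric] continuous_map_componentwise_UNIV
  proof (intro conjI allI)
    fix k
    have "continuous_map ?P euclideanreal (\<lambda>p. fst p * snd p k)"
    proof (rule continuous_map_real_mult)
      show "continuous_map ?P euclideanreal fst"
        using continuous_map_fst[of ?T ?S] by (simp add: continuous_map_in_subtopology)
      show "continuous_map ?P euclideanreal (\<lambda>p. snd p k)"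
        using continuous_map_compose[OF continuous_map_snd[of ?T ?S] continuous_map_nsphere_projection[of m k]] by (simp add: o_def)
    qed
    then show "continuous_map ?P euclideanreal (\<lambda>p. (case p of (t, x) \<Rightarrow> \<lambda>i. t * x i) k)"
      by (simp add: case_prod_beta)
  qed (use in_cube in auto)
  from continuous_map_compose[OF this conts]
  have H: "continuous_map ?P ?S (s \<circ> (\<lambda>(t, x) i. t * x i))" .
  have "homotopic_with (\<lambda>x. True) ?S ?S (\<lambda>x. s (\<lambda>i. 0)) id"
    unfolding homotopic_with_def
  proof (intro exI conjI allI impI ballI)
    \<comment> \<open>The ends of a homotopy must agree with the given maps at all arguments, also
      off the sphere, where the normalised map is not the identity; hence the case distinction at
      time 1.\<close>
    show "continuous_map ?P ?S (\<lambda>p. if fst p = 1 then snd p else s (\<lambda>i. fst p * snd p i))"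
    proof (rule continuous_map_eq[OF H])
      fix p assume p: "p \<in> topspace ?P"
      then have x: "snd p \<in> topspace ?S" by auto
      have "s (snd p) = snd p"
      proof
        fix i
        have c: "snd p \<in> cube n" "(\<Sum>i<n. (snd p i)\<^sup>2) = 1" using in_cube[OF x, of 1] x by (auto simp: tS)
        then have "r (snd p) = 1" using id[OF c] by (simp add: r_def)
        then show "s (snd p) i = snd p i" using id[OF c] x by (auto simp: s_def tS)
      qed
      then show "(s \<circ> (\<lambda>(t, x) i. t * x i)) p = (if fst p = 1 then snd p else s (\<lambda>i. fst p * snd p i))"
        by (simp add: case_prod_beta)
    qed
  qed auto
  then have "contractible_space ?S"
    unfolding contractible_space_def by (metis homotopic_with_sym)
  then show False using non_contractible_space_nsphere by blast
qed

section \<open>Lattices close to the integer lattice\<close>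

lemma compact_cube: "compact (cube n)"
  unfolding cube_def by (rule compact_box)

text \<open>A convergent sequence in \<open>H\<close> eventually stays in one ball, whose trace on
  \<open>H\<close> is finite and therefore closed.\<close>

lemma finite_norm1_ball_imp_closed:
  assumes I: "finite I" and fin: "\<And>B. finite {x \<in> H. norm1 I x \<le> B}"
  shows "closed H"
  unfolding closed_sequential_limits
proof (intro allI impI, elim conjE)
  fix f l assume f: "\<forall>n. f n \<in> H" "f \<longlonglongrightarrow> l"
  let ?S = "{x \<in> H. norm1 I x \<le> norm1 I l + 1}"
  have "closed ?S" by (rule finite_imp_closed[OF fin])
  moreover have "eventually (\<lambda>n. norm1 I (f n) < norm1 I l + 1) sequentially"
    using tendsto_norm1[OF I f(2)] by (rule order_tendstoD) simp
  then have "eventually (\<lambda>n. f n \<in> ?S) sequentially"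
    by eventually_elim (use f(1) in auto)
  ultimately have "l \<in> ?S" using f(2) by (intro Lim_in_closed_set[of ?S f sequentially]) auto
  then show "l \<in> H" by simp
qed

lemma lin_comb_cong: "(\<And>j. j \<in> I \<Longrightarrow> h j = h' j) \<Longrightarrow> lin_comb I w h = lin_comb I w h'"
  unfolding lin_comb_def by (intro ext sum.cong) auto

text \<open>The coefficient bound leaves finitely many integer coefficient vectors for the lattice
  points in a given ball; this gives closedness.\<close>

lemma lattice_of_Ints_closed_subgroup:
  assumes x: "x \<in> good_params d (\<lambda>_. \<int>) c" and c: "0 \<le> c"
  shows "lattice_of d (\<lambda>_. \<int>) x \<in> closed_subgroups d"
  unfolding closed_subgroups_iff
proof (intro conjI)
  let ?w = "basis_of d x"
  show "closed (lattice_of d (\<lambda>_. \<int>) x)"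
  proof (rule finite_norm1_ball_imp_closed)
    fix B
    let ?Z = "{k \<in> \<int>. \<bar>k\<bar> \<le> c * B}"
    have "{y \<in> lattice_of d (\<lambda>_. \<int>) x. norm1 {..<d} y \<le> B} \<subseteq> lin_comb {..<d} ?w ` ({..<d} \<rightarrow>\<^sub>E ?Z)"
    proof
      fix y assume "y \<in> {y \<in> lattice_of d (\<lambda>_. \<int>) x. norm1 {..<d} y \<le> B}"
      then obtain h where h: "\<forall>j\<in>{..<d}. h j \<in> \<int>" "y = lin_comb {..<d} ?w h" "norm1 {..<d} y \<le> B"
        by (auto simp: lattice_of_def)
      have "norm1 {..<d} h \<le> c * norm1 {..<d} y" using x h(1,2) by (auto simp: good_params_def)
      also have "\<dots> \<le> c * B" using h(3) c by (rule mult_left_mono)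
      finally have "\<bar>h j\<bar> \<le> c * B" if "j < d" for j using norm1_ge[of "{..<d}" j h] that by simp
      then have "restrict h {..<d} \<in> {..<d} \<rightarrow>\<^sub>E ?Z" using h(1) by auto
      moreover have "y = lin_comb {..<d} ?w (restrict h {..<d})" unfolding h(2) by (rule lin_comb_cong) simp
      ultimately show "y \<in> lin_comb {..<d} ?w ` ({..<d} \<rightarrow>\<^sub>E ?Z)" 
        by (intro image_eqI[of _ _ "restrict h {..<d}"])
    qed
    moreover have "finite ({..<d} \<rightarrow>\<^sub>E ?Z)" by (intro finite_PiE finite_abs_int_segment) auto
    ultimately show "finite {y \<in> lattice_of d (\<lambda>_. \<int>) x. norm1 {..<d} y \<le> B}" by (blast intro: finite_subset)
  qed simp
  show "lattice_of d (\<lambda>_. \<int>) x \<subseteq> fin_vecs {..<d}"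
    by (auto simp: lattice_of_def fin_vecs_def lin_comb_def basis_of_def)
  show "add_subgroup (lattice_of d (\<lambda>_. \<int>) x)"
    unfolding add_subgroup_def
  proof (intro conjI ballI)
    show "(\<lambda>i. 0) \<in> lattice_of d (\<lambda>_. \<int>) x"
      unfolding lattice_of_def by (intro image_eqI[of _ _ "\<lambda>_. 0"]) (auto simp: lin_comb_def)
    fix y assume "y \<in> lattice_of d (\<lambda>_. \<int>) x"
    then obtain h where h: "\<forall>j\<in>{..<d}. h j \<in> \<int>" "y = lin_comb {..<d} ?w h" by (auto simp: lattice_of_def)
    show "(\<lambda>i. - y i) \<in> lattice_of d (\<lambda>_. \<int>) x"
      unfolding lattice_of_def h(2)
      by (intro image_eqI[of _ _ "\<lambda>j. - h j"]) (use h(1) in \<open>auto simp: lin_comb_def sum_negf\<close>)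
    fix z assume "z \<in> lattice_of d (\<lambda>_. \<int>) x"
    then obtain k where k: "\<forall>j\<in>{..<d}. k j \<in> \<int>" "z = lin_comb {..<d} ?w k" by (auto simp: lattice_of_def)
    show "(\<lambda>i. y i + z i) \<in> lattice_of d (\<lambda>_. \<int>) x"
      unfolding lattice_of_def h(2) k(2)
      by (intro image_eqI[of _ _ "\<lambda>j. h j + k j"])
        (use h(1) k(1) in \<open>auto simp: lin_comb_def sum.distrib distrib_right\<close>)
  qed
qed

text \<open>The matrix \<open>I + y / (8 (d + 1))\<close> in the indexing of \<open>basis_of\<close>.\<close>
definition near_id :: "nat \<Rightarrow> (nat \<Rightarrow> real) \<Rightarrow> nat \<Rightarrow> real" where
  "near_id d y k = (if k div d = k mod d then 1 else 0) + y k / (8 * (real d + 1))"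

lemma lin_comb_id:
  assumes "i < d"
  shows "lin_comb {..<d} (basis_of d (near_id d (\<lambda>_. 0))) h i = h i"
proof -
  have "lin_comb {..<d} (basis_of d (near_id d (\<lambda>_. 0))) h i = (\<Sum>j<d. if j = i then h j else 0)"
    unfolding lin_comb_def using assms by (intro sum.cong) (auto simp: basis_of_def near_id_def)
  then show ?thesis using assms by simp
qed

lemma near_id_perturb:
  assumes "y \<in> cube (d\<^sup>2)" "k < d\<^sup>2"
  shows "\<bar>near_id d (\<lambda>_. 0) k - near_id d y k\<bar> \<le> 1 / (8 * (real d + 1))"
proof -
  have "\<bar>near_id d (\<lambda>_. 0) k - near_id d y k\<bar> = \<bar>y k\<bar> / (8 * (real d + 1))" by (simp add: near_id_def)
  also have "\<dots> \<le> 1 / (8 * (real d + 1))" using assms by (intro divide_right_mono) (auto simp: cube_def)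
  finally show ?thesis .
qed

text \<open>Each entry is off by at most \<open>1 / (8 * (real d + 1))\<close>, and \<open>d\<close>
  coordinates add up to a factor below \<open>1 / 8\<close>. The 8 is chosen for
  \<open>cube_lattice_inj\<close>: two such errors, doubled by \<open>near_id_bound\<close>, make
  \<open>1 / 2\<close>.\<close>

lemma near_id_lin_comb:
  assumes "y \<in> cube (d\<^sup>2)"
  shows "norm1 {..<d} (\<lambda>i. h i - lin_comb {..<d} (basis_of d (near_id d y)) h i) \<le> norm1 {..<d} h / 8"
proof -
  let ?e = "1 / (8 * (real d + 1))"
  have "norm1 {..<d} (\<lambda>i. h i - lin_comb {..<d} (basis_of d (near_id d y)) h i) =
      norm1 {..<d} (\<lambda>i. lin_comb {..<d} (basis_of d (near_id d (\<lambda>_. 0))) h i - lin_comb {..<d} (basis_of d (near_id d y)) h i)"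
    unfolding norm1_def by (intro sum.cong) (auto simp: lin_comb_id)
  also have "\<dots> \<le> real d * ?e * norm1 {..<d} h"
    using near_id_perturb[OF assms] by (rule lin_comb_basis_perturb)
  also have "\<dots> \<le> 1 / 8 * norm1 {..<d} h" by (intro mult_right_mono) (auto simp: field_simps)
  finally show ?thesis by simp
qed

lemma near_id_bound:
  assumes "y \<in> cube (d\<^sup>2)"
  shows "norm1 {..<d} h \<le> 2 * norm1 {..<d} (lin_comb {..<d} (basis_of d (near_id d y)) h)"
proof -
  let ?l = "lin_comb {..<d} (basis_of d (near_id d y)) h"
  have "norm1 {..<d} h = norm1 {..<d} (\<lambda>i. (h i - ?l i) + ?l i)" by simp
  also have "\<dots> \<le> norm1 {..<d} (\<lambda>i. h i - ?l i) + norm1 {..<d} ?l" by (rule norm1_add)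
  finally have "norm1 {..<d} h \<le> norm1 {..<d} h / 8 + norm1 {..<d} ?l" using near_id_lin_comb[OF assms, of h] by simp
  moreover have "0 \<le> norm1 {..<d} h" by simp
  ultimately show ?thesis by linarith
qed

definition cube_lattice :: "nat \<Rightarrow> (nat \<Rightarrow> real) \<Rightarrow> (nat \<Rightarrow> real) set" where
  "cube_lattice d y = lattice_of d (\<lambda>_. \<int>) (near_id d y)"

lemma near_id_good: "y \<in> cube (d\<^sup>2) \<Longrightarrow> near_id d y \<in> good_params d (\<lambda>_. \<int>) 2"
  by (simp add: good_params_def near_id_bound)

lemma cube_lattice_closed_subgroup: "y \<in> cube (d\<^sup>2) \<Longrightarrow> cube_lattice d y \<in> closed_subgroups d"
  unfolding cube_lattice_def by (rule lattice_of_Ints_closed_subgroup[OF near_id_good]) auto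

text \<open>If two lattices coincide, the \<open>j\<close>-th basis vector of the first is an integer combination of
  the basis of the second whose coefficients differ from those of the \<open>j\<close>-th basis vector of the
  second by less than \<open>1\<close>.\<close>
lemma cube_lattice_inj:
  assumes y: "y \<in> cube (d\<^sup>2)" "y' \<in> cube (d\<^sup>2)" and eq: "cube_lattice d y = cube_lattice d y'"
  shows "y = y'"
proof
  fix k
  show "y k = y' k"
  proof (cases "k < d\<^sup>2")
    case False
    then show ?thesis using y by (simp add: cube_def)
  next
    case True
    let ?w = "basis_of d (near_id d y)" and ?w' = "basis_of d (near_id d y')" and ?n = "norm1 {..<d}"
    define j where "j = k div d"
    define i where "i = k mod d"
    have d0: "0 < d" using True by (cases "d = 0") auto
    have ij: "j < d" "i < d" using True d0 by (auto simp: j_def i_def power2_eq_square less_mult_imp_div_less)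
    have k: "k = j * d + i" by (simp add: j_def i_def)
    define e where "e = (\<lambda>l. if l = j then 1 else 0 :: real)"
    have le: "lin_comb {..<d} w e = w j" for w
      using ij(1) by (simp add: lin_comb_def e_def if_distrib[of "\<lambda>x. x * _"] cong: if_cong)
    have "lin_comb {..<d} ?w e \<in> cube_lattice d y"
      unfolding cube_lattice_def lattice_of_def by (intro imageI) (auto simp: e_def)
    then obtain z where z: "\<forall>l\<in>{..<d}. z l \<in> \<int>" "lin_comb {..<d} ?w e = lin_comb {..<d} ?w' z"
      unfolding eq by (auto simp: cube_lattice_def lattice_of_def)
    let ?h = "\<lambda>l. z l - e l"
    have "?n ?h \<le> 2 * ?n (lin_comb {..<d} ?w' ?h)" by (rule near_id_bound[OF y(2)])
    also have "lin_comb {..<d} ?w' ?h = (\<lambda>i. lin_comb {..<d} ?w' z i - lin_comb {..<d} ?w' e i)"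
      by (simp add: lin_comb_def left_diff_distrib sum_subtractf)
    \<comment> \<open>\<open>z\<close> gives the same vector in the second basis as \<open>e\<close>
      in the first, so only the two deviations from the identity at the unit vector \<open>e\<close>
      remain.\<close>
    also have "\<dots> = (\<lambda>i. (e i - lin_comb {..<d} ?w' e i) - (e i - lin_comb {..<d} ?w e i))"
      unfolding z(2)[symmetric] by simp
    also have "?n \<dots> \<le> ?n e / 8 + ?n e / 8"
      by (intro order_trans[OF norm1_diff] add_mono near_id_lin_comb y)
    also have "?n e = 1" using ij(1) by (simp add: norm1_def e_def if_distrib[of abs] cong: if_cong)
    finally have n: "?n ?h \<le> 1 / 2" by simp
    have "z l = e l" if "l \<in> {..<d}" for l
    proof -
      have "\<bar>z l - e l\<bar> < 1" using norm1_ge[of "{..<d}" l ?h] that n by simp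
      moreover have "z l - e l \<in> \<int>" using z(1) that by (auto simp: e_def)
      ultimately show ?thesis using Ints_nonzero_abs_less1 by fastforce
    qed
    then have "lin_comb {..<d} ?w' z = lin_comb {..<d} ?w' e" by (rule lin_comb_cong)
    then have "?w j i = ?w' j i" using z(2) le by metis
    then show ?thesis using ij k by (simp add: basis_of_def near_id_def)
  qed
qed

text \<open>By \<open>dist_nbhd_Sub_space\<close> continuity can be tested on the distances. These
  are Lipschitz in \<open>y\<close>, because all matrices from the cube satisfy the coefficient
  bound with the same constant 2.\<close>

lemma continuous_map_cube_lattice: "continuous_map (top_of_set (cube (d\<^sup>2))) (Sub_space d) (cube_lattice d)"
proof -
  let ?N = "d\<^sup>2"
  let ?Y = "top_of_set (cube ?N)"
  have dist: "continuous_map ?Y euclideanreal (\<lambda>y. dist1 d q (cube_lattice d y))" for q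
  proof -
    define C where "C = 2 * real d * 2 * (1 / (8 * (real d + 1))) * norm1 {..<d} q"
    have lip: "\<bar>dist1 d q (cube_lattice d y) - dist1 d q (cube_lattice d y')\<bar> \<le> C * norm1 {..<?N} (\<lambda>i. y i - y' i)"
      if "y \<in> cube ?N" "y' \<in> cube ?N" for y y'
    proof -
      let ?\<eta> = "1 / (8 * (real d + 1)) * norm1 {..<?N} (\<lambda>i. y i - y' i)"
      have "\<bar>near_id d y k - near_id d y' k\<bar> \<le> ?\<eta>" if "k < ?N" for k
      proof -
        have "near_id d y k - near_id d y' k = 1 / (8 * (real d + 1)) * (y k - y' k)"
          by (simp add: near_id_def diff_divide_distrib)
        then show ?thesis using norm1_ge[of "{..<?N}" k "\<lambda>i. y i - y' i"] that
          by (simp only: abs_mult) (intro mult_mono; simp)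
      qed
      then have "\<bar>dist1 d q (cube_lattice d y) - dist1 d q (cube_lattice d y')\<bar> \<le> 2 * real d * 2 * ?\<eta> * norm1 {..<d} q"
        unfolding cube_lattice_def using that by (intro dist1_lattice_Lipschitz near_id_good) auto
      then show ?thesis by (simp add: C_def mult_ac)
    qed
    have "continuous_on (cube ?N) (\<lambda>y. dist1 d q (cube_lattice d y))"
      unfolding continuous_on_def
    proof
      fix y assume y: "y \<in> cube ?N"
      have "((\<lambda>y'. y') \<longlongrightarrow> y) (at y within cube ?N)" by (rule tendsto_ident_at)
      then have "((\<lambda>y' i. y' i - y i) \<longlongrightarrow> (\<lambda>i. 0)) (at y within cube ?N)"
        unfolding tendsto_fun_iff by (auto intro: tendsto_eq_intros)
      from tendsto_mult[OF tendsto_const tendsto_norm1[OF _ this, of "{..<?N}"], of C]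
      have lim: "((\<lambda>y'. C * norm1 {..<?N} (\<lambda>i. y' i - y i)) \<longlongrightarrow> 0) (at y within cube ?N)"
        by (simp add: norm1_def)
      have "eventually (\<lambda>y'. norm (dist1 d q (cube_lattice d y') - dist1 d q (cube_lattice d y)) \<le> C * norm1 {..<?N} (\<lambda>i. y' i - y i)) (at y within cube ?N)"
        unfolding eventually_at_filter using lip y by (intro always_eventually) auto
      from Lim_null_comparison[OF this lim]
      show "((\<lambda>y. dist1 d q (cube_lattice d y)) \<longlongrightarrow> dist1 d q (cube_lattice d y)) (at y within cube ?N)"
        by (rule LIM_zero_cancel)
    qed
    then show ?thesis by (simp add: continuous_map_iff_continuous)
  qed
  have funs: "continuous_map ?Y euclideanreal (\<lambda>y. \<phi> (cube_lattice d y))" if "\<phi> \<in> dist_funs d" for \<phi>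
    using that dist unfolding dist_funs_def by (auto simp: divide_inverse intro!: continuous_on_mult_right)
  show ?thesis
    unfolding continuous_map_def
  proof (intro conjI allI impI)
    show "cube_lattice d \<in> topspace ?Y \<rightarrow> topspace (Sub_space d)"
      by (auto simp: topspace_Sub_space cube_lattice_closed_subgroup)
    fix U assume U: "openin (Sub_space d) U"
    show "openin ?Y {y \<in> topspace ?Y. cube_lattice d y \<in> U}"
    proof (subst openin_subopen, intro ballI)
      fix y assume y: "y \<in> {y \<in> topspace ?Y. cube_lattice d y \<in> U}"
      have "dist_nbhd d (cube_lattice d y) U" using y by (intro dist_nbhd_Sub_space[OF U]) simp
      then obtain Q e where Q: "finite Q" "Q \<subseteq> dist_funs d" "0 < e"
        "{G \<in> closed_subgroups d. \<forall>\<phi>\<in>Q. \<bar>\<phi> G - \<phi> (cube_lattice d y)\<bar> < e} \<subseteq> U"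
        unfolding dist_nbhd_def by (elim exE conjE)
      define g where "g = (\<lambda>y'. \<Sum>\<phi>\<in>Q. \<bar>\<phi> (cube_lattice d y') - \<phi> (cube_lattice d y)\<bar>)"
      have "continuous_map ?Y euclideanreal g"
        unfolding g_def using Q(1,2) funs
        by (intro continuous_map_sum continuous_map_real_abs continuous_map_diff) auto
      then have o: "openin ?Y {y' \<in> topspace ?Y. g y' \<in> {..<e}}" by (rule openin_continuous_map_preimage) simp
      have "cube_lattice d y' \<in> U" if "y' \<in> cube ?N" "g y' < e" for y'
      proof -
        have "\<bar>\<phi> (cube_lattice d y') - \<phi> (cube_lattice d y)\<bar> < e" if "\<phi> \<in> Q" for \<phi>
          using member_le_sum[OF that, of "\<lambda>\<phi>. \<bar>\<phi> (cube_lattice d y') - \<phi> (cube_lattice d y)\<bar>"] Q(1) \<open>g y' < e\<close>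
          by (simp add: g_def)
        then show ?thesis using Q(4) cube_lattice_closed_subgroup[OF that(1)] by blast
      qed
      moreover have "g y = 0" by (simp add: g_def)
      ultimately show "\<exists>T. openin ?Y T \<and> y \<in> T \<and> T \<subseteq> {y \<in> topspace ?Y. cube_lattice d y \<in> U}"
        using y Q(3) by (intro exI[of _ "{y' \<in> topspace ?Y. g y' \<in> {..<e}}"] conjI o) auto
    qed
  qed
qed

text \<open>A point of one group outside the other has distance 0 from the first and positive
  distance from the second, which is closed; so the continuous distances separate.\<close>

lemma Hausdorff_Sub_space: "Hausdorff_space (Sub_space d)"
  unfolding Hausdorff_space_def topspace_Sub_space
proof (intro allI impI, elim conjE)
  have sep: "\<exists>q. dist1 d q F \<noteq> dist1 d q G" if FG: "F \<in> closed_subgroups d" "G \<in> closed_subgroups d" "q \<in> F" "q \<notin> G" for F G q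
    using dist1_pos[OF FG(2) closed_subgroups_fin_vecs[OF FG(1,3)] FG(4)] dist1_self[OF FG(3), of d] by (intro exI[of _ q]) simp
  fix F G assume FG: "F \<in> closed_subgroups d" "G \<in> closed_subgroups d" "F \<noteq> G"
  then consider q where "q \<in> F" "q \<notin> G" | q where "q \<in> G" "q \<notin> F" by blast
  then obtain q where "dist1 d q F \<noteq> dist1 d q G" using sep[OF FG(1,2)] sep[OF FG(2,1)] by cases metis+
  then obtain A B where AB: "open A" "open B" "dist1 d q F \<in> A" "dist1 d q G \<in> B" "A \<inter> B = {}"
    using separation_t2 by metis
  have "openin (Sub_space d) {F \<in> topspace (Sub_space d). dist1 d q F \<in> A}"
    "openin (Sub_space d) {F \<in> topspace (Sub_space d). dist1 d q F \<in> B}"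
    using AB by (auto intro: openin_continuous_map_preimage[OF continuous_map_dist1])
  then show "\<exists>U V. openin (Sub_space d) U \<and> openin (Sub_space d) V \<and> F \<in> U \<and> G \<in> V \<and> disjnt U V"
    using AB FG unfolding topspace_Sub_space
    by (intro exI[of _ "{F \<in> closed_subgroups d. dist1 d q F \<in> A}"] exI[of _ "{F \<in> closed_subgroups d. dist1 d q F \<in> B}"])
      (auto simp: disjnt_def)
qed

lemma not_ind_le_Sub_space: "\<not> ind_le (d\<^sup>2) (Sub_space d)"
proof
  let ?N = "d\<^sup>2"
  assume dim: "ind_le ?N (Sub_space d)"
  let ?Y = "top_of_set (cube ?N)"
  \<comment> \<open>The extension property is applied to the image of the cube, a compact Hausdorff
    subspace that inherits the dimension bound.\<close>
  define X where "X = subtopology (Sub_space d) (cube_lattice d ` cube ?N)"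
  have zero: "(\<lambda>i. 0) \<in> cube ?N" by (simp add: cube_def)
  show False
  proof (cases "?N = 0")
    case True
    \<comment> \<open>For \<open>d = 0\<close> the assumption says that the space is empty, but it
      contains a subgroup.\<close>
    then show False using dim cube_lattice_closed_subgroup[OF zero] by (simp add: topspace_Sub_space)
  next
    case False
    have cX: "continuous_map ?Y X (cube_lattice d)"
      unfolding X_def continuous_map_in_subtopology using continuous_map_cube_lattice by auto
    have tX: "topspace X = cube_lattice d ` cube ?N"
      using cube_lattice_closed_subgroup by (auto simp: X_def topspace_Sub_space)
    have H: "Hausdorff_space X" unfolding X_def by (intro Hausdorff_space_subtopology Hausdorff_Sub_space)
    have cY: "compact_space ?Y" using compact_cube by (simp add: compact_space_subtopology)
    have hom: "homeomorphic_map ?Y X (cube_lattice d)"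
      by (rule continuous_imp_homeomorphic_map[OF cX cY H]) (auto simp: tX inj_on_def intro: cube_lattice_inj)
    have cpX: "compact_space X" using hom cY homeomorphic_compact_space homeomorphic_map_imp_homeomorphic_space by blast
    obtain \<psi> where \<psi>: "homeomorphic_maps ?Y X (cube_lattice d) \<psi>" using hom homeomorphic_map_maps by blast
    then have c\<psi>: "continuous_map X ?Y \<psi>" and \<psi>y: "\<And>y. y \<in> cube ?N \<Longrightarrow> \<psi> (cube_lattice d y) = y"
      by (auto simp: homeomorphic_maps_def)
    have "ind_le ?N X" unfolding X_def by (rule ind_le_subtopology[OF dim])
    then have "ind_le ?N (subtopology X (topspace X))" by simp
    then have ext: "rel_ext X ?N (topspace X)" using ind_le_imp_rel_ext[OF cpX H closedin_topspace] by blast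
    have cf: "continuous_map X euclideanreal (\<lambda>F. \<psi> F i)" for i
    proof -
      have "continuous_map ?Y euclideanreal (\<lambda>y. y i)"
        by (simp add: continuous_map_iff_continuous continuous_on_subset[OF continuous_on_coordinate])
      from continuous_map_compose[OF c\<psi> this] show ?thesis by (simp add: o_def)
    qed
    \<comment> \<open>The copy of the unit sphere. The coordinates of \<open>\<psi>\<close> have no
      common zero there, and an extension without zeros to all of \<open>X\<close> would contradict
      \<open>no_retraction_cube\<close>.\<close>
    define E where "E = {F \<in> topspace X. (\<Sum>i<?N. (\<psi> F i)\<^sup>2) \<in> {1}}"
    have E: "closedin X E" unfolding E_def
      by (rule closedin_continuous_map_preimage[where Y = euclideanreal])
        (auto intro!: continuous_map_sum continuous_map_real_pow cf)
    have nz: "\<exists>i<?N. \<psi> F i \<noteq> 0" if "F \<in> E" for F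
    proof (rule ccontr)
      assume "\<not> ?thesis"
      then have "(\<Sum>i<?N. (\<psi> F i)\<^sup>2) = 0" by (intro sum.neutral) auto
      then show False using that by (simp add: E_def)
    qed
    obtain g where g: "\<And>i. i < ?N \<Longrightarrow> continuous_map X euclideanreal (g i)"
      "\<And>F i. F \<in> E \<Longrightarrow> i < ?N \<Longrightarrow> g i F = \<psi> F i" "\<And>F. F \<in> topspace X \<Longrightarrow> \<exists>i<?N. g i F \<noteq> 0"
      by (rule rel_extD[OF ext E, of "\<lambda>i F. \<psi> F i"]) (use cf nz in auto)
    have "\<exists>y\<in>cube ?N. \<forall>i<?N. g i (cube_lattice d y) = 0"
    proof (rule no_retraction_cube)
      show "0 < ?N" using False by simp
      show "continuous_map ?Y euclideanreal (\<lambda>y. g i (cube_lattice d y))" if "i < ?N" for i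
        using continuous_map_compose[OF cX g(1)[OF that]] by (simp add: o_def)
      show "g i (cube_lattice d y) = y i" if "y \<in> cube ?N" "(\<Sum>i<?N. (y i)\<^sup>2) = 1" "i < ?N" for y i
        using g(2)[of "cube_lattice d y" i] that by (simp add: E_def tX \<psi>y)
    qed
    then show False using g(3) tX by blast
  qed
qed

theorem theorem8p2:
  fixes d :: nat
  shows "indim_eq (Sub_space d) (d ^ 2)"
  unfolding indim_eq_def using ind_le_Sub_space not_ind_le_Sub_space by blast

end
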